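(* Let $T>0$ and let $n\ge 1$ be an integer. Let $(\eta_\varepsilon)_{\varepsilon>0}$ be a family of processes with trajectories in the Cameron–Martin space $\mathcal H$, of the form $\eta_\varepsilon(t)=\int_0^t\theta_\varepsilon(s)\,ds$, $t\in[0,T]$. Assume that the finite dimensional distributions of $(\eta_\varepsilon)_{\varepsilon>0}$ converge in law, as $\varepsilon$ tends to $0$, to the finite dimensional distributions of a standard Brownian motion $W$ on $[0,T]$. For $f\in L^2([0,T]^n)$ and $t\in[0,T]$ put $$Y^f_{\eta_\varepsilon}(t)=\int_{[0,t]^n} f(x_1,\dots,x_n)\prod_{i=1}^n\theta_\varepsilon(x_i)\prod_{\substack{i,j=1\\ i\neq j}}^n I_{\{|x_i-x_j|>\varepsilon\}}\,dx_1\cdots dx_n .$$ Assume also that there exists a positive constant $C$ such that $$\sup_{\varepsilon>0,\;t\in[0,T]}E\big|Y^f_{\eta_\varepsilon}(t)\big|\le C\,\|f\|_{L^2([0,T]^n)}\qquad\text{for all } f\in L^2([0,T]^n).$$ Then, for all $f\in L^2([0,T]^n)$, the finite dimensional distributions of the family of processes $\{Y^f_{\eta_\varepsilon}\}_{\varepsilon>0}$ converge in law, as $\varepsilon$ tends to $0$, to those of the multiple Wiener–Itô integral process $\big(I_n(f\cdot I_{[0,t]^n})\big)_{t\in[0,T]}$.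
   Context: The Cameron–Martin space is $\mathcal H=\{\eta\in\mathcal C([0,T]):\ \eta_t=\int_0^t\eta'_s\,ds,\ \eta'\in L^2([0,T])\}$; thus $\theta_\varepsilon$ is a process whose sample paths are in $L^2([0,T])$. $I_A$ (with a set or an event as subscript) denotes an indicator function. $I_n$ (with an integer as subscript) denotes the $n$-fold multiple Wiener–Itô integral over $[0,T]^n$ with respect to the standard Brownian motion $W$, in Itô's (1951) normalization: it is the continuous linear map from $L^2([0,T]^n)$ to $L^2(\Omega)$ for which $I_n\big(I_{(a^1,b^1]\times\cdots\times(a^n,b^n]}\big)=\prod_{i=1}^n [W(b^i)-W(a^i)]$ whenever the intervals $[a^i,b^i]\subset[0,T]$ are pairwise disjoint. The function $f$ need not be symmetric. *)

theory Defs
  imports "HOL-Probability.Probability"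
begin

text \<open>
  Elements of $L^2$ are represented by measurable functions. On Euclidean domains this means
  Borel functions; every Lebesgue class has such a representative, and all notions below depend
  only on the class.
\<close>

definition square_integrable :: "'a measure \<Rightarrow> ('a \<Rightarrow> real) \<Rightarrow> bool" where
  "square_integrable M f \<longleftrightarrow> f \<in> borel_measurable M \<and> integrable M (\<lambda>x. (f x)\<^sup>2)"

definition l2norm :: "'a measure \<Rightarrow> ('a \<Rightarrow> real) \<Rightarrow> real" where
  "l2norm M f = sqrt (LINT x|M. (f x)\<^sup>2)"

text \<open>Lebesgue measure on $[0,T]^n$; points are functions on the index set \<open>{..<n}\<close>.\<close>

definition lborel_cube :: "nat \<Rightarrow> real \<Rightarrow> (nat \<Rightarrow> real) measure" where
  "lborel_cube n T = PiM {..<n} (\<lambda>_. restrict_space lborel {0..T})"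

locale standard_brownian_motion = prob_space N
  for T :: real and N :: "'b measure" and W :: "real \<Rightarrow> 'b \<Rightarrow> real" +
  assumes measurable_W: "\<And>t. t \<in> {0..T} \<Longrightarrow> W t \<in> borel_measurable N"
    and W_0: "AE \<omega> in N. W 0 \<omega> = 0"
    and normal_increments: "\<And>s t. \<lbrakk>0 \<le> s; s < t; t \<le> T\<rbrakk> \<Longrightarrow>
      distributed N lborel (\<lambda>\<omega>. W t \<omega> - W s \<omega>) (normal_density 0 (sqrt (t - s)))"
    and indep_increments: "\<And>(k::nat) t. \<lbrakk>\<forall>i\<le>k. t i \<in> {0..T}; \<forall>i<k. t i \<le> t (Suc i)\<rbrakk> \<Longrightarrow>
      indep_vars (\<lambda>_. borel) (\<lambda>i \<omega>. W (t (Suc i)) \<omega> - W (t i) \<omega>) {..<k}"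
    and continuous_paths: "AE \<omega> in N. continuous_on {0..T} (\<lambda>t. W t \<omega>)"

text \<open>
  \<open>I\<close> is the \<open>n\<close>-fold multiple Wiener-Ito integral with respect to \<open>W\<close>: a continuous (that is,
  bounded) linear map from $L^2([0,T]^n)$ to $L^2(N)$ with the prescribed values on
  off-diagonal rectangles, which determine it. Since \<open>I\<close> acts on representatives, the identities
  hold almost surely; linearity and boundedness make it well defined on classes.
\<close>

definition multiple_wiener_ito_integral ::
  "nat \<Rightarrow> real \<Rightarrow> 'b measure \<Rightarrow> (real \<Rightarrow> 'b \<Rightarrow> real) \<Rightarrow> (((nat \<Rightarrow> real) \<Rightarrow> real) \<Rightarrow> 'b \<Rightarrow> real) \<Rightarrow> bool"
where
  "multiple_wiener_ito_integral n T N W I \<longleftrightarrow>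
    (\<forall>f. square_integrable (lborel_cube n T) f \<longrightarrow> square_integrable N (I f)) \<and>
    (\<forall>f g. square_integrable (lborel_cube n T) f \<longrightarrow> square_integrable (lborel_cube n T) g \<longrightarrow>
      (AE \<omega> in N. I (\<lambda>x. f x + g x) \<omega> = I f \<omega> + I g \<omega>)) \<and>
    (\<forall>c f. square_integrable (lborel_cube n T) f \<longrightarrow>
      (AE \<omega> in N. I (\<lambda>x. c * f x) \<omega> = c * I f \<omega>)) \<and>
    (\<exists>K. \<forall>f. square_integrable (lborel_cube n T) f \<longrightarrow>
      l2norm N (I f) \<le> K * l2norm (lborel_cube n T) f) \<and>
    (\<forall>a b. (\<forall>i<n. 0 \<le> a i \<and> a i < b i \<and> b i \<le> T) \<longrightarrow>
      disjoint_family_on (\<lambda>i. {a i<..b i}) {..<n} \<longrightarrow>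
      (AE \<omega> in N. I (indicator (PiE {..<n} (\<lambda>i. {a i<..b i}))) \<omega> =
        (\<Prod>i<n. W (b i) \<omega> - W (a i) \<omega>)))"

text \<open>
  Weak convergence, as $\varepsilon \downarrow 0$, of all finite dimensional distributions of the
  processes \<open>(X \<epsilon> t)\<close>, \<open>t \<in> S\<close>, to those of \<open>(Z t)\<close>, \<open>t \<in> S\<close>, tested against bounded continuous
  functions. Each \<open>X \<epsilon>\<close> may live on its own probability space. \<open>Euclidean_space k\<close> consists of the
  sequences that vanish from index \<open>k\<close> on. The measurability clauses say that \<open>X \<epsilon>\<close> and \<open>Z\<close> are
  processes; they keep the Bochner integrals from being 0 by convention.
\<close>

definition fdd_converge_in_law ::
  "real set \<Rightarrow> (real \<Rightarrow> 'a measure) \<Rightarrow> (real \<Rightarrow> real \<Rightarrow> 'a \<Rightarrow> real) \<Rightarrow>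
    'b measure \<Rightarrow> (real \<Rightarrow> 'b \<Rightarrow> real) \<Rightarrow> bool"
where
  "fdd_converge_in_law S M X N Z \<longleftrightarrow>
    (\<forall>\<epsilon>>0. \<forall>t\<in>S. X \<epsilon> t \<in> borel_measurable (M \<epsilon>)) \<and>
    (\<forall>t\<in>S. Z t \<in> borel_measurable N) \<and>
    (\<forall>(k::nat) t g. (\<forall>i<k. t i \<in> S) \<longrightarrow>
      continuous_map (Euclidean_space k) euclideanreal g \<longrightarrow>
      bounded (g ` topspace (Euclidean_space k)) \<longrightarrow>
      ((\<lambda>\<epsilon>. LINT \<omega>|M \<epsilon>. g (\<lambda>i. if i < k then X \<epsilon> (t i) \<omega> else 0)) \<longlongrightarrow>
        (LINT \<omega>|N. g (\<lambda>i. if i < k then Z (t i) \<omega> else 0))) (at_right 0))"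

text \<open>The value $Y^f(t)$ for a single sample path \<open>h\<close> of the derivative process.\<close>

definition off_diagonal_integral ::
  "nat \<Rightarrow> real \<Rightarrow> real \<Rightarrow> ((nat \<Rightarrow> real) \<Rightarrow> real) \<Rightarrow> (real \<Rightarrow> real) \<Rightarrow> real \<Rightarrow> real"
where
  "off_diagonal_integral n T \<epsilon> f h t =
    (LINT x:PiE {..<n} (\<lambda>_. {0..t})|lborel_cube n T.
      f x * (\<Prod>i<n. h (x i)) *
      (\<Prod>(i, j)\<in>{(i, j). i < n \<and> j < n \<and> i \<noteq> j}. indicator {\<epsilon><..} \<bar>x i - x j\<bar>))"

end

theory Submission imports Defs begin

text \<open>
  The law of $Y^f(t)$ depends on \<open>f\<close> continuously, uniformly in \<open>\<epsilon>\<close>: the hypothesis bounds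
  $E|Y^f(t) - Y^e(t)| = E|Y^{f-e}(t)|$ by $C\,\|f-e\|$. The multiple integral satisfies a bound of
  the same kind. It is therefore enough to prove the convergence for a dense set of integrands \<open>e\<close>,
  and then to pass to the limit.

  The dense set consists of the linear combinations of indicators of boxes
  $\prod_i (a_i, b_i]$ whose sides have pairwise positive distance. On such a box the condition
  $|x_i-x_j|>\varepsilon$ holds automatically once \<open>\<epsilon>\<close> is small, so Fubini's theorem turns
  $Y^e(t)$ into $\prod_i (\eta(b_i \wedge t) - \eta(a_i \wedge t))$, while the multiple integral is
  $\prod_i (W(b_i \wedge t) - W(a_i \wedge t))$ by definition. Both are the same polynomial in
  finitely many values of the path (\<open>step_function_representation\<close>), and the convergence of the
  finite dimensional distributions of $\eta$ carries over by continuous mapping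
  (\<open>fdd_converge_in_law_functional\<close>).

  Density (\<open>step_functions_dense\<close>) rests on two facts. Inside one separated box the smaller
  separated boxes generate the sigma-algebra, so a Dynkin argument approximates every measurable
  subset. Countably many separated boxes cover the cube up to the diagonals and the faces $x_i = 0$,
  which are null sets; this is where the null diagonal enters.

  The passage to the limit (\<open>weak_limit_by_approximation_in_mean\<close>) has to handle test functions that
  are bounded and continuous but not uniformly continuous. The uniform bound on $E|Y^f(t)|$
  supplies the tightness that confines the argument to a compact set.

  Only the values of $\eta$ are assumed to be random variables, not the density $\theta$ as a
  function of both arguments. Measurability of $Y^f(t)$ comes from density as well: for each outcome
  $Y^f(t)$ is a limit of polynomials in values of $\eta$ (\<open>product_pairing_measurable\<close>).
\<close>

section \<open>Square-integrable functions\<close>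

lemma square_integrable_mult_integrable:
  assumes "square_integrable M f" "square_integrable M g"
  shows "integrable M (\<lambda>x. f x * g x)"
proof (rule Bochner_Integration.integrable_bound)
  show "integrable M (\<lambda>x. (f x)\<^sup>2 + (g x)\<^sup>2)"
    using assms by (auto simp: square_integrable_def)
  show "(\<lambda>x. f x * g x) \<in> borel_measurable M"
    using assms by (auto simp: square_integrable_def)
  show "AE x in M. norm (f x * g x) \<le> norm ((f x)\<^sup>2 + (g x)\<^sup>2)"
  proof (intro AE_I2)
    fix x
    have "2 * (\<bar>f x\<bar> * \<bar>g x\<bar>) \<le> (f x)\<^sup>2 + (g x)\<^sup>2"
      using sum_squares_bound[of "\<bar>f x\<bar>" "\<bar>g x\<bar>"] by simp
    moreover have "0 \<le> \<bar>f x\<bar> * \<bar>g x\<bar>" by simp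
    ultimately have "\<bar>f x\<bar> * \<bar>g x\<bar> \<le> (f x)\<^sup>2 + (g x)\<^sup>2" by linarith
    then show "norm (f x * g x) \<le> norm ((f x)\<^sup>2 + (g x)\<^sup>2)" by (simp add: abs_mult)
  qed
qed

lemma square_integrable_add:
  assumes f: "square_integrable M f" and g: "square_integrable M g"
  shows "square_integrable M (\<lambda>x. f x + g x)"
  using f g square_integrable_mult_integrable[OF f g]
  by (auto simp: square_integrable_def power2_sum mult.assoc)

lemma square_integrable_scale:
  "square_integrable M f \<Longrightarrow> square_integrable M (\<lambda>x. c * f x)"
  by (auto simp: square_integrable_def power_mult_distrib)

lemma square_integrable_diff:
  assumes f: "square_integrable M f" and g: "square_integrable M g"
  shows "square_integrable M (\<lambda>x. f x - g x)"
  using square_integrable_add[OF f square_integrable_scale[OF g, of "-1"]] by simp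

lemma square_integrable_bound:
  assumes "square_integrable M f" "g \<in> borel_measurable M" "\<And>x. x \<in> space M \<Longrightarrow> \<bar>g x\<bar> \<le> \<bar>f x\<bar>"
  shows "square_integrable M g"
  unfolding square_integrable_def
proof
  show "integrable M (\<lambda>x. (g x)\<^sup>2)"
    by (rule Bochner_Integration.integrable_bound[where f = "\<lambda>x. (f x)\<^sup>2"])
      (use assms in \<open>auto simp: square_integrable_def abs_le_square_iff\<close>)
qed (fact assms)

lemma square_integrable_mult_indicator:
  assumes "square_integrable M f" "A \<in> sets M"
  shows "square_integrable M (\<lambda>x. f x * indicator A x)"
  using assms
  by (intro square_integrable_bound[OF assms(1)])
     (auto simp: square_integrable_def indicator_def)

lemma (in finite_measure) square_integrable_indicator:
  assumes "A \<inter> space M \<in> sets M"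
  shows "square_integrable M (indicator A)"
proof -
  have *: "(indicator A :: _ \<Rightarrow> real) \<in> borel_measurable M"
    using assms by (simp add: borel_measurable_indicator_iff)
  have "(\<lambda>x. (indicator A x :: real)\<^sup>2) = indicator A"
    by (auto simp: indicator_def fun_eq_iff)
  then show ?thesis
    using * assms by (simp add: square_integrable_def integrable_indicator_iff less_top[symmetric])
qed

lemma integral_square_sum_le:
  assumes f: "square_integrable M f" and g: "square_integrable M g"
  shows "(LINT x|M. (f x + g x)\<^sup>2) \<le> 2 * (LINT x|M. (f x)\<^sup>2) + 2 * (LINT x|M. (g x)\<^sup>2)"
proof -
  have "(LINT x|M. (f x + g x)\<^sup>2) \<le> (LINT x|M. 2 * (f x)\<^sup>2 + 2 * (g x)\<^sup>2)"
  proof (rule integral_mono)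
    show "integrable M (\<lambda>x. (f x + g x)\<^sup>2)"
      using square_integrable_add[OF f g] by (simp add: square_integrable_def)
    show "integrable M (\<lambda>x. 2 * (f x)\<^sup>2 + 2 * (g x)\<^sup>2)"
      using f g by (simp add: square_integrable_def)
    fix x
    show "(f x + g x)\<^sup>2 \<le> 2 * (f x)\<^sup>2 + 2 * (g x)\<^sup>2"
      using sum_squares_bound[of "f x" "g x"] by (simp add: power2_sum)
  qed
  also have "\<dots> = 2 * (LINT x|M. (f x)\<^sup>2) + 2 * (LINT x|M. (g x)\<^sup>2)"
    using f g by (simp add: square_integrable_def)
  finally show ?thesis .
qed

text \<open>The factor 2 is the one with which simple functions dominated by a measurable function
  approximate it.\<close>

lemma integral_square_diff_tendsto_0:
  assumes f: "square_integrable M f" and g: "\<And>m. g m \<in> borel_measurable M"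
    and lim: "AE x in M. (\<lambda>m. g m x) \<longlonglongrightarrow> f x"
    and bd: "\<And>m. AE x in M. \<bar>g m x\<bar> \<le> 2 * \<bar>f x\<bar>"
  shows "(\<lambda>m. LINT x|M. (f x - g m x)\<^sup>2) \<longlonglongrightarrow> 0"
proof -
  have fm: "f \<in> borel_measurable M" using f by (simp add: square_integrable_def)
  have "(\<lambda>m. LINT x|M. (f x - g m x)\<^sup>2) \<longlonglongrightarrow> (LINT x|M. 0)"
  proof (rule integral_dominated_convergence[where w = "\<lambda>x. 9 * (f x)\<^sup>2"])
    show "integrable M (\<lambda>x. 9 * (f x)\<^sup>2)" using f by (simp add: square_integrable_def)
    show "(\<lambda>x. (f x - g m x)\<^sup>2) \<in> borel_measurable M" for m using fm g by measurable
    show "AE x in M. (\<lambda>m. (f x - g m x)\<^sup>2) \<longlonglongrightarrow> 0"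
      using lim
    proof eventually_elim
      fix x assume "(\<lambda>m. g m x) \<longlonglongrightarrow> f x"
      then have "(\<lambda>m. (f x - g m x)\<^sup>2) \<longlonglongrightarrow> (f x - f x)\<^sup>2" by (intro tendsto_intros)
      then show "(\<lambda>m. (f x - g m x)\<^sup>2) \<longlonglongrightarrow> 0" by simp
    qed
    show "AE x in M. norm ((f x - g m x)\<^sup>2) \<le> 9 * (f x)\<^sup>2" for m
      using bd[of m]
    proof eventually_elim
      fix x assume "\<bar>g m x\<bar> \<le> 2 * \<bar>f x\<bar>"
      then have "\<bar>f x - g m x\<bar> \<le> \<bar>3 * f x\<bar>" by (auto simp: abs_mult)
      then have "(f x - g m x)\<^sup>2 \<le> (3 * f x)\<^sup>2" by (simp only: abs_le_square_iff)
      then show "norm ((f x - g m x)\<^sup>2) \<le> 9 * (f x)\<^sup>2" by (simp add: power_mult_distrib)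
    qed
  qed auto
  then show ?thesis by simp
qed

section \<open>Lebesgue measure on the cube\<close>

lemma finite_measure_interval: "finite_measure (restrict_space lborel {0..T::real})"
  by (rule finite_measureI) (simp add: space_restrict_space emeasure_restrict_space emeasure_lborel_Icc_eq)

lemma product_sigma_finite_interval:
  "product_sigma_finite (\<lambda>_::nat. restrict_space lborel {0..T::real})"
  unfolding product_sigma_finite_def
  using finite_measure.axioms(1)[OF finite_measure_interval] by simp

lemma space_interval [simp]: "space (restrict_space lborel {0..T::real}) = {0..T}"
  by (simp add: space_restrict_space)

lemma space_lborel_cube: "space (lborel_cube n T) = PiE {..<n} (\<lambda>_. {0..T})"
  by (simp add: lborel_cube_def space_PiM)

lemma coordinate_measurable [measurable]:
  assumes "i < n"
  shows "(\<lambda>x. x i) \<in> borel_measurable (lborel_cube n T)"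
proof -
  have "(\<lambda>x. x i) \<in> measurable (lborel_cube n T) (restrict_space lborel {0..T})"
    unfolding lborel_cube_def using assms by (intro measurable_component_singleton) auto
  then show ?thesis by (auto simp: measurable_restrict_space2_iff)
qed

lemma finite_measure_lborel_cube: "finite_measure (lborel_cube n T)"
proof -
  interpret product_sigma_finite "\<lambda>_::nat. restrict_space lborel {0..T}"
    by (rule product_sigma_finite_interval)
  have "emeasure (lborel_cube n T) (space (lborel_cube n T)) =
     (\<Prod>i<n. emeasure (restrict_space lborel {0..T}) {0..T})"
    unfolding lborel_cube_def space_PiM
    by (subst emeasure_PiM) (auto intro!: prod.cong simp: sets_restrict_space_iff)
  also have "\<dots> \<noteq> top"
    using finite_measure.emeasure_finite[OF finite_measure_interval, of T "{0..T}"]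
    by (simp add: power_eq_top_ennreal)
  finally show ?thesis by (intro finite_measureI) auto
qed

lemma PiE_in_sets_lborel_cube:
  assumes "\<And>i. i < n \<Longrightarrow> A i \<in> sets borel" "\<And>i. i < n \<Longrightarrow> A i \<subseteq> {0..T}"
  shows "PiE {..<n} A \<in> sets (lborel_cube n T)"
  unfolding lborel_cube_def
  by (rule sets_PiM_I_finite) (use assms in \<open>auto simp: sets_restrict_space_iff\<close>)

text \<open>Fubini in the coordinate \<open>i\<close>: a condition that, for fixed other coordinates, forbids only
  one value of \<open>x i\<close> holds almost everywhere.\<close>

lemma AE_lborel_cube_coordinate:
  assumes i: "i < n" and P: "Measurable.pred (lborel_cube n T) P"
    and ex: "\<And>x. \<exists>c. \<forall>y. \<not> P (x(i := y)) \<longrightarrow> y = c"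
  shows "AE x in lborel_cube n T. P x"
proof -
  interpret product_sigma_finite "\<lambda>_::nat. restrict_space lborel {0..T}"
    by (rule product_sigma_finite_interval)
  let ?L = "restrict_space lborel {0..T}" and ?J = "{..<n} - {i}"
  have n: "{..<n} = insert i ?J" using i by auto
  let ?N = "{x \<in> space (lborel_cube n T). \<not> P x}"
  have meas: "?N \<in> sets (lborel_cube n T)" using P by measurable
  have "emeasure (lborel_cube n T) ?N = (\<integral>\<^sup>+x. indicator ?N x \<partial>lborel_cube n T)"
    using meas by simp
  also have "\<dots> = (\<integral>\<^sup>+x. (\<integral>\<^sup>+y. indicator ?N (x(i := y)) \<partial>?L) \<partial>PiM ?J (\<lambda>_. ?L))"
  proof -
    have cube: "lborel_cube n T = PiM (insert i ?J) (\<lambda>_. ?L)"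
      unfolding lborel_cube_def using n by (rule arg_cong)
    have "(indicator ?N :: _ \<Rightarrow> ennreal) \<in> borel_measurable (PiM (insert i ?J) (\<lambda>_. ?L))"
      using meas unfolding cube[symmetric] by (rule borel_measurable_indicator)
    then show ?thesis
      unfolding cube by (intro product_nn_integral_insert) auto
  qed
  also have "\<dots> = (\<integral>\<^sup>+x. 0 \<partial>PiM ?J (\<lambda>_. ?L))"
  proof (rule nn_integral_cong)
    fix x
    obtain c where c: "\<And>y. \<not> P (x(i := y)) \<Longrightarrow> y = c" using ex by blast
    have "AE y in ?L. y \<noteq> c"
      using AE_lborel_singleton[of c] by (auto simp: AE_restrict_space_iff elim!: eventually_mono)
    then have "(\<integral>\<^sup>+y. indicator ?N (x(i := y)) \<partial>?L) = (\<integral>\<^sup>+y. 0 \<partial>?L)"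
      by (intro nn_integral_cong_AE) (auto elim!: eventually_mono simp: indicator_def intro: ccontr dest: c)
    then show "(\<integral>\<^sup>+y. indicator ?N (x(i := y)) \<partial>?L) = 0" by simp
  qed
  finally have "emeasure (lborel_cube n T) ?N = 0" by simp
  then show ?thesis using meas by (intro AE_I'[of ?N]) (auto simp: null_sets_def)
qed

text \<open>Half-open intervals contained in $[0,T]$ miss the point 0, so the faces $x_i = 0$ have to be
  discarded together with the diagonals.\<close>

lemma AE_lborel_cube_off_diagonal:
  "AE x in lborel_cube n T. (\<forall>i<n. 0 < x i) \<and> (\<forall>i<n. \<forall>j<n. i \<noteq> j \<longrightarrow> x i \<noteq> x j)"
proof -
  have "AE x in lborel_cube n T. 0 < x i" if i: "i < n" for i
  proof -
    have "AE x in lborel_cube n T. x i \<noteq> 0"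
      using coordinate_measurable[OF i]
      by (intro AE_lborel_cube_coordinate[OF i]) (auto simp: pred_def intro: borel_measurable_neq)
    moreover have "0 \<le> x i" if "x \<in> space (lborel_cube n T)" for x
      using that i by (auto simp: space_lborel_cube PiE_iff)
    ultimately show ?thesis
      using AE_space[of "lborel_cube n T"] by (auto elim!: eventually_elim2 simp: less_le)
  qed
  then have 1: "AE x in lborel_cube n T. \<forall>i\<in>{..<n}. 0 < x i"
    by (subst AE_finite_all) auto
  have "AE x in lborel_cube n T. i \<noteq> j \<longrightarrow> x i \<noteq> x j" if "i < n" "j < n" for i j
  proof (cases "i = j")
    case False
    then have "AE x in lborel_cube n T. x i \<noteq> x j"
      using coordinate_measurable[OF that(1)] coordinate_measurable[OF that(2)]
      by (intro AE_lborel_cube_coordinate[OF that(1)])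
         (auto simp: pred_def intro: borel_measurable_neq)
    then show ?thesis by eventually_elim simp
  qed simp
  then have 2: "AE x in lborel_cube n T. \<forall>i\<in>{..<n}. \<forall>j\<in>{..<n}. i \<noteq> j \<longrightarrow> x i \<noteq> x j"
    by (subst AE_finite_all, simp, intro ballI, subst AE_finite_all) auto
  show ?thesis using 1 2 by eventually_elim auto
qed

section \<open>Step functions supported away from the diagonals\<close>

definition half_open_box :: "nat \<Rightarrow> (nat \<Rightarrow> real) \<Rightarrow> (nat \<Rightarrow> real) \<Rightarrow> (nat \<Rightarrow> real) set" where
  "half_open_box n a b = PiE {..<n} (\<lambda>i. {a i<..b i})"

text \<open>Strict inequalities between the sides keep a box at positive distance from every diagonal;
  empty sides are admitted, so that separated boxes are closed under intersection with products of
  half-lines.\<close>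

definition separated_bounds :: "nat \<Rightarrow> real \<Rightarrow> (nat \<Rightarrow> real) \<Rightarrow> (nat \<Rightarrow> real) \<Rightarrow> bool" where
  "separated_bounds n T a b \<longleftrightarrow> (\<forall>i<n. 0 \<le> a i \<and> a i \<le> b i \<and> b i \<le> T) \<and>
     (\<forall>i<n. \<forall>j<n. i \<noteq> j \<longrightarrow> b i < a j \<or> b j < a i)"

inductive_set step_functions :: "nat \<Rightarrow> real \<Rightarrow> ((nat \<Rightarrow> real) \<Rightarrow> real) set" for n T where
  zero: "(\<lambda>x. 0) \<in> step_functions n T"
| box: "separated_bounds n T a b \<Longrightarrow> indicator (half_open_box n a b) \<in> step_functions n T"
| add: "e \<in> step_functions n T \<Longrightarrow> e' \<in> step_functions n T \<Longrightarrow> (\<lambda>x. e x + e' x) \<in> step_functions n T"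
| scale: "e \<in> step_functions n T \<Longrightarrow> (\<lambda>x. c * e x) \<in> step_functions n T"

lemma half_open_box_in_sets:
  assumes "\<And>i. i < n \<Longrightarrow> 0 \<le> a i \<and> b i \<le> T"
  shows "half_open_box n a b \<in> sets (lborel_cube n T)"
  unfolding half_open_box_def
proof (rule PiE_in_sets_lborel_cube)
  fix i assume "i < n"
  then show "{a i<..b i} \<subseteq> {0..T}" using assms[of i] by auto
qed auto

lemma separated_box_in_sets:
  "separated_bounds n T a b \<Longrightarrow> half_open_box n a b \<in> sets (lborel_cube n T)"
  by (rule half_open_box_in_sets) (auto simp: separated_bounds_def)

lemma square_integrable_cube_indicator:
  "A \<in> sets (lborel_cube n T) \<Longrightarrow> square_integrable (lborel_cube n T) (indicator A)"
  using finite_measure.square_integrable_indicator[OF finite_measure_lborel_cube] by blast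

lemma square_integrable_zero: "square_integrable M (\<lambda>x. 0)"
  by (simp add: square_integrable_def)

lemma square_integrable_step:
  "e \<in> step_functions n T \<Longrightarrow> square_integrable (lborel_cube n T) e"
  by (induction rule: step_functions.induct)
     (auto intro: square_integrable_zero square_integrable_add square_integrable_scale
        square_integrable_cube_indicator separated_box_in_sets)

section \<open>Density of the step functions in $L^2$\<close>

definition l2_approximable :: "nat \<Rightarrow> real \<Rightarrow> ((nat \<Rightarrow> real) \<Rightarrow> real) \<Rightarrow> bool" where
  "l2_approximable n T f \<longleftrightarrow> square_integrable (lborel_cube n T) f \<and>
     (\<forall>\<delta>>0. \<exists>e\<in>step_functions n T. (LINT x|lborel_cube n T. (f x - e x)\<^sup>2) < \<delta>)"

lemma l2_approximable_square_integrable: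
  "l2_approximable n T f \<Longrightarrow> square_integrable (lborel_cube n T) f"
  by (simp add: l2_approximable_def)

lemma l2_approximable_step: "e \<in> step_functions n T \<Longrightarrow> l2_approximable n T e"
  unfolding l2_approximable_def by (force intro: square_integrable_step bexI[of _ e])

lemma l2_approximable_empty: "l2_approximable n T (indicator {})"
proof -
  have "(indicator {} :: (nat \<Rightarrow> real) \<Rightarrow> real) = (\<lambda>x. 0)" by (simp add: fun_eq_iff)
  then show ?thesis using l2_approximable_step[OF step_functions.zero] by simp
qed

lemma l2_approximable_limit:
  assumes f: "square_integrable (lborel_cube n T) f" and g: "\<And>m. l2_approximable n T (g m)"
    and lim: "(\<lambda>m. LINT x|lborel_cube n T. (f x - g m x)\<^sup>2) \<longlonglongrightarrow> 0"
  shows "l2_approximable n T f"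
  unfolding l2_approximable_def
proof (intro conjI allI impI f)
  fix \<delta> :: real assume "\<delta> > 0"
  then have \<delta>: "\<delta> / 4 > 0" by simp
  obtain m where m: "(LINT x|lborel_cube n T. (f x - g m x)\<^sup>2) < \<delta> / 4"
    using order_tendstoD(2)[OF lim \<delta>] by (auto simp: eventually_sequentially)
  obtain e where e: "e \<in> step_functions n T" "(LINT x|lborel_cube n T. (g m x - e x)\<^sup>2) < \<delta> / 4"
    using g[of m] \<delta> unfolding l2_approximable_def by blast
  have "(LINT x|lborel_cube n T. ((f x - g m x) + (g m x - e x))\<^sup>2) \<le>
    2 * (LINT x|lborel_cube n T. (f x - g m x)\<^sup>2) + 2 * (LINT x|lborel_cube n T. (g m x - e x)\<^sup>2)"
    by (intro integral_square_sum_le square_integrable_diff f square_integrable_step e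
        l2_approximable_square_integrable g)
  also have "\<dots> < \<delta>" using m e(2) by simp
  finally show "\<exists>e\<in>step_functions n T. (LINT x|lborel_cube n T. (f x - e x)\<^sup>2) < \<delta>"
    using e(1) by auto
qed

lemma l2_approximable_dominated_limit:
  assumes f: "square_integrable (lborel_cube n T) f" and g: "\<And>m. l2_approximable n T (g m)"
    and lim: "AE x in lborel_cube n T. (\<lambda>m. g m x) \<longlonglongrightarrow> f x"
    and bd: "\<And>m. AE x in lborel_cube n T. \<bar>g m x\<bar> \<le> 2 * \<bar>f x\<bar>"
  shows "l2_approximable n T f"
  using f g integral_square_diff_tendsto_0[OF f _ lim bd]
  by (intro l2_approximable_limit[OF f g]) (auto simp: l2_approximable_def square_integrable_def)

lemma l2_approximable_add:
  assumes f: "l2_approximable n T f" and g: "l2_approximable n T g"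
  shows "l2_approximable n T (\<lambda>x. f x + g x)"
  unfolding l2_approximable_def
proof (intro conjI allI impI)
  show "square_integrable (lborel_cube n T) (\<lambda>x. f x + g x)"
    using f g by (auto simp: l2_approximable_def intro: square_integrable_add)
  fix \<delta> :: real assume "\<delta> > 0"
  then have \<delta>: "\<delta> / 4 > 0" by simp
  obtain e where e: "e \<in> step_functions n T" "(LINT x|lborel_cube n T. (f x - e x)\<^sup>2) < \<delta> / 4"
    using f \<delta> unfolding l2_approximable_def by blast
  obtain e' where e': "e' \<in> step_functions n T" "(LINT x|lborel_cube n T. (g x - e' x)\<^sup>2) < \<delta> / 4"
    using g \<delta> unfolding l2_approximable_def by blast
  have "(LINT x|lborel_cube n T. ((f x - e x) + (g x - e' x))\<^sup>2) \<le>
    2 * (LINT x|lborel_cube n T. (f x - e x)\<^sup>2) + 2 * (LINT x|lborel_cube n T. (g x - e' x)\<^sup>2)"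
    by (intro integral_square_sum_le square_integrable_diff square_integrable_step e e'
        l2_approximable_square_integrable f g)
  also have "\<dots> < \<delta>" using e(2) e'(2) by simp
  finally have "(LINT x|lborel_cube n T. ((f x + g x) - (e x + e' x))\<^sup>2) < \<delta>"
    by (simp add: algebra_simps)
  then show "\<exists>e\<in>step_functions n T. (LINT x|lborel_cube n T. (f x + g x - e x)\<^sup>2) < \<delta>"
    using step_functions.add[OF e(1) e'(1)] by (intro bexI[of _ "\<lambda>x. e x + e' x"]) auto
qed

lemma l2_approximable_scale:
  assumes f: "l2_approximable n T f"
  shows "l2_approximable n T (\<lambda>x. c * f x)"
  unfolding l2_approximable_def
proof (intro conjI allI impI)
  show "square_integrable (lborel_cube n T) (\<lambda>x. c * f x)"
    using f by (auto simp: l2_approximable_def intro: square_integrable_scale)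
  fix \<delta> :: real assume "\<delta> > 0"
  then have "\<delta> / (c\<^sup>2 + 1) > 0" by (simp add: add_nonneg_pos)
  then obtain e where e: "e \<in> step_functions n T"
      "(LINT x|lborel_cube n T. (f x - e x)\<^sup>2) < \<delta> / (c\<^sup>2 + 1)"
    using f unfolding l2_approximable_def by blast
  have "(LINT x|lborel_cube n T. (c * f x - c * e x)\<^sup>2)
      = c\<^sup>2 * (LINT x|lborel_cube n T. (f x - e x)\<^sup>2)"
    by (simp add: right_diff_distrib[symmetric] power_mult_distrib)
  also have "\<dots> \<le> (c\<^sup>2 + 1) * (LINT x|lborel_cube n T. (f x - e x)\<^sup>2)"
    by (intro mult_right_mono) auto
  also have "\<dots> < (c\<^sup>2 + 1) * (\<delta> / (c\<^sup>2 + 1))"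
    using e(2) by (intro mult_strict_left_mono) (auto simp: add_nonneg_pos)
  also have "\<dots> = \<delta>" by (simp add: add_nonneg_eq_0_iff)
  finally show "\<exists>e\<in>step_functions n T. (LINT x|lborel_cube n T. (c * f x - e x)\<^sup>2) < \<delta>"
    using step_functions.scale[OF e(1)] by (intro bexI[of _ "\<lambda>x. c * e x"]) auto
qed

lemma l2_approximable_diff:
  "l2_approximable n T f \<Longrightarrow> l2_approximable n T g \<Longrightarrow> l2_approximable n T (\<lambda>x. f x - g x)"
  using l2_approximable_add[of n T f "\<lambda>x. -1 * g x"] l2_approximable_scale[of n T g "-1"] by simp

lemma l2_approximable_sum:
  "finite I \<Longrightarrow> (\<And>i. i \<in> I \<Longrightarrow> l2_approximable n T (f i)) \<Longrightarrow> l2_approximable n T (\<lambda>x. \<Sum>i\<in>I. f i x)"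
  by (induction I rule: finite_induct)
     (auto intro: l2_approximable_add l2_approximable_step step_functions.zero)

text \<open>Sets on which the approximation problem can be solved locally. They are closed under countable
  unions, so that approximability of all indicators follows from a countable cover.\<close>

definition localizing :: "nat \<Rightarrow> real \<Rightarrow> (nat \<Rightarrow> real) set \<Rightarrow> bool" where
  "localizing n T B \<longleftrightarrow> B \<in> sets (lborel_cube n T) \<and>
     (\<forall>A\<in>sets (lborel_cube n T). l2_approximable n T (indicator (A \<inter> B)))"

definition half_line_boxes :: "nat \<Rightarrow> real \<Rightarrow> (nat \<Rightarrow> real) set set" where
  "half_line_boxes n T = {PiE {..<n} (\<lambda>i. {0..T} \<inter> {..c i}) | c. True}"

lemma Int_stable_half_line_boxes: "Int_stable (half_line_boxes n T)"
proof (rule Int_stableI)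
  fix A B assume "A \<in> half_line_boxes n T" "B \<in> half_line_boxes n T"
  then obtain c d where A: "A = PiE {..<n} (\<lambda>i. {0..T} \<inter> {..c i})"
    and B: "B = PiE {..<n} (\<lambda>i. {0..T} \<inter> {..d i})"
    by (auto simp: half_line_boxes_def)
  have "A \<inter> B = PiE {..<n} (\<lambda>i. {0..T} \<inter> {..min (c i) (d i)})"
    unfolding A B PiE_Int by (intro PiE_cong) auto
  then show "A \<inter> B \<in> half_line_boxes n T"
    by (auto simp: half_line_boxes_def intro!: exI[of _ "\<lambda>i. min (c i) (d i)"])
qed

lemma half_line_boxes_subset: "half_line_boxes n T \<subseteq> Pow (space (lborel_cube n T))"
  by (fastforce simp: half_line_boxes_def space_lborel_cube PiE_iff)

lemma PiE_Int_eq_Collect: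
  "PiE I (\<lambda>i. C \<inter> D i) = {f \<in> PiE I (\<lambda>_. C). \<forall>i\<in>I. f i \<in> C \<inter> D i}"
  by (auto simp: PiE_iff extensional_def)

lemma sets_lborel_cube_half_lines:
  "sets (lborel_cube n T) = sigma_sets (space (lborel_cube n T)) (half_line_boxes n T)"
proof -
  let ?L = "restrict_space lborel {0..T}"
  let ?E = "range (\<lambda>c. {0..T} \<inter> {..c})"
  have Icc: "{0..T} \<in> sigma_sets UNIV (range (\<lambda>c::real. {..c}))"
  proof -
    have "{0..T} \<in> sets (borel :: real measure)" by simp
    then show ?thesis unfolding borel_eq_atMost by (simp add: sets_measure_of)
  qed
  have gen: "sets ?L = sigma_sets (space ?L) ?E"
  proof -
    have 1: "sets ?L = (\<inter>) {0..T} ` sigma_sets UNIV (range (\<lambda>c::real. {..c}))"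
      by (simp add: sets_restrict_space borel_eq_atMost sets_measure_of)
    have 2: "(\<inter>) {0..T} ` sigma_sets UNIV (range (\<lambda>c::real. {..c}))
        = sigma_sets {0..T} ((\<inter>) {0..T} ` range (\<lambda>c::real. {..c}))"
      by (rule sigma_sets_Int[OF Icc]) simp
    have 3: "(\<inter>) {0..T} ` range (\<lambda>c::real. {..c}) = ?E" by (rule image_image)
    show ?thesis unfolding space_interval 1 2 3 ..
  qed
  have E: "?E \<subseteq> Pow {0..T}" by auto
  have box_eq: "PiE {..<n} (\<lambda>i. {0..T} \<inter> {..c i})
      = {f \<in> PiE {..<n} (\<lambda>_. {0..T}). \<forall>i\<in>{..<n}. f i \<in> {0..T} \<inter> {..c i}}" for c :: "nat \<Rightarrow> real"
    by (rule PiE_Int_eq_Collect)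
  have "sets (lborel_cube n T) = sets (PiM {..<n} (\<lambda>_. sigma {0..T} ?E))"
    unfolding lborel_cube_def
    using gen E by (intro sets_PiM_cong) simp_all
  moreover have "sets (PiM {..<n} (\<lambda>_. sigma {0..T} ?E)) = sets (sigma (PiE {..<n} (\<lambda>_. {0..T}))
      {{f \<in> PiE {..<n} (\<lambda>_. {0..T}). \<forall>i\<in>j. f i \<in> A i} | A j. j \<in> {{..<n}} \<and> A \<in> Pi j (\<lambda>_. ?E)})"
  proof (rule sets_PiM_sigma)
    show "\<exists>S\<subseteq>?E. countable S \<and> {0..T} = \<Union>S"
      by (intro exI[of _ "{{0..T} \<inter> {..T}}"]) auto
  qed auto
  moreover have "{{f \<in> PiE {..<n} (\<lambda>_. {0..T}). \<forall>i\<in>j. f i \<in> A i} | A j. j \<in> {{..<n}} \<and> A \<in> Pi j (\<lambda>_. ?E)}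
      = half_line_boxes n T" (is "?P = _")
  proof (intro set_eqI iffI)
    fix B assume "B \<in> ?P"
    then obtain A where B: "B = {f \<in> PiE {..<n} (\<lambda>_. {0..T}). \<forall>i\<in>{..<n}. f i \<in> A i}"
      and "A \<in> Pi {..<n} (\<lambda>_. ?E)"
      by blast
    then have "\<forall>i\<in>{..<n}. \<exists>c. A i = {0..T} \<inter> {..c}" by auto
    from bchoice[OF this] obtain c where c: "\<forall>i\<in>{..<n}. A i = {0..T} \<inter> {..c i}" by blast
    have "B = PiE {..<n} (\<lambda>i. {0..T} \<inter> {..c i})"
      unfolding B box_eq using c by (intro Collect_cong conj_cong ball_cong refl) simp
    then show "B \<in> half_line_boxes n T" by (auto simp: half_line_boxes_def)
  next
    fix B assume "B \<in> half_line_boxes n T"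
    then obtain c where B: "B = PiE {..<n} (\<lambda>i. {0..T} \<inter> {..c i})"
      by (auto simp: half_line_boxes_def)
    have "(\<lambda>i. {0..T} \<inter> {..c i}) \<in> Pi {..<n} (\<lambda>_. ?E)"
      by (intro Pi_I) (rule rangeI)
    with B[unfolded box_eq] show "B \<in> ?P"
      by (intro CollectI exI[of _ "\<lambda>i. {0..T} \<inter> {..c i}"] exI[of _ "{..<n}"] conjI singletonI)
  qed
  ultimately have "sets (lborel_cube n T) = sets (sigma (PiE {..<n} (\<lambda>_. {0..T})) (half_line_boxes n T))"
    by (simp only:)
  also have "\<dots> = sigma_sets (PiE {..<n} (\<lambda>_. {0..T})) (half_line_boxes n T)"
    using half_line_boxes_subset[of n T] unfolding space_lborel_cube by (rule sets_measure_of)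
  finally show ?thesis by (simp only: space_lborel_cube)
qed

text \<open>Dynkin's argument inside one separated box: its traces on the generators of the product
  sigma-algebra are again separated boxes, and the sets whose trace is approximable form a Dynkin
  system.\<close>

lemma localizing_separated_box:
  assumes ab: "separated_bounds n T a b"
  shows "localizing n T (half_open_box n a b)"
  unfolding localizing_def
proof (intro conjI ballI)
  let ?B = "half_open_box n a b"
  show B: "?B \<in> sets (lborel_cube n T)" by (rule separated_box_in_sets[OF ab])
  fix A assume "A \<in> sets (lborel_cube n T)"
  then have A: "A \<in> sigma_sets (space (lborel_cube n T)) (half_line_boxes n T)"
    by (simp add: sets_lborel_cube_half_lines)
  from Int_stable_half_line_boxes half_line_boxes_subset A
  show "l2_approximable n T (indicator (A \<inter> ?B))"
  proof (induction rule: sigma_sets_induct_disjoint)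
    case (basic A)
    then obtain c where A: "A = PiE {..<n} (\<lambda>i. {0..T} \<inter> {..c i})"
      by (auto simp: half_line_boxes_def)
    define b' where "b' i = max (a i) (min (b i) (c i))" for i
    have "{0..T} \<inter> {..c i} \<inter> {a i<..b i} = {a i<..b' i}" if "i < n" for i
      using ab that by (fastforce simp: separated_bounds_def b'_def)
    then have "A \<inter> ?B = half_open_box n a b'"
      unfolding A half_open_box_def PiE_Int by (intro PiE_cong) auto
    moreover have "b' i \<le> b i" if "i < n" for i
      using ab that by (auto simp: separated_bounds_def b'_def)
    then have "separated_bounds n T a b'"
      using ab unfolding separated_bounds_def by (fastforce simp: b'_def)
    ultimately show ?case
      by (simp add: l2_approximable_step step_functions.box)
  next
    case empty
    show ?case unfolding Int_empty_left by (rule l2_approximable_empty)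
  next
    case (compl A)
    have "(indicator ((space (lborel_cube n T) - A) \<inter> ?B) :: _ \<Rightarrow> real) =
        (\<lambda>x. indicator ?B x - indicator (A \<inter> ?B) x)"
      using sets.sets_into_space[OF B] by (auto simp: indicator_def fun_eq_iff)
    then show ?case
      using l2_approximable_diff[OF l2_approximable_step[OF step_functions.box[OF ab]] compl.IH]
      by simp
  next
    case (union A)
    have Asets: "A i \<in> sets (lborel_cube n T)" for i
      using union.hyps(2) by (auto simp: sets_lborel_cube_half_lines)
    have sums: "(\<lambda>i. indicator (A i \<inter> ?B) x :: real) sums indicator (\<Union>i. A i \<inter> ?B) x" for x
      by (rule indicator_sums) (use union.hyps(1) in \<open>auto simp: disjoint_family_on_def\<close>)
    have "l2_approximable n T (indicator (\<Union>i. A i \<inter> ?B))"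
    proof (rule l2_approximable_dominated_limit[where g = "\<lambda>m x. \<Sum>i<m. indicator (A i \<inter> ?B) x"])
      show "square_integrable (lborel_cube n T) (indicator (\<Union>i. A i \<inter> ?B))"
        using Asets B by (intro square_integrable_cube_indicator) auto
      show "l2_approximable n T (\<lambda>x. \<Sum>i<m. indicator (A i \<inter> ?B) x)" for m
        using union.IH by (intro l2_approximable_sum) auto
      show "AE x in lborel_cube n T. (\<lambda>m. \<Sum>i<m. indicator (A i \<inter> ?B) x) \<longlonglongrightarrow>
          (indicator (\<Union>i. A i \<inter> ?B) x :: real)"
        using sums by (simp add: sums_def)
      show "AE x in lborel_cube n T. \<bar>\<Sum>i<m. indicator (A i \<inter> ?B) x\<bar> \<le>
          2 * \<bar>indicator (\<Union>i. A i \<inter> ?B) x :: real\<bar>" for m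
      proof (intro AE_I2)
        fix x
        have "(\<Sum>i<m. indicator (A i \<inter> ?B) x :: real) \<le> indicator (\<Union>i. A i \<inter> ?B) x"
          using sum_le_suminf[OF sums_summable[OF sums[of x]], of "{..<m}"] sums_unique[OF sums[of x]]
          by simp
        moreover have "0 \<le> (\<Sum>i<m. indicator (A i \<inter> ?B) x :: real)" by (intro sum_nonneg) auto
        ultimately show "\<bar>\<Sum>i<m. indicator (A i \<inter> ?B) x\<bar> \<le>
          2 * \<bar>indicator (\<Union>i. A i \<inter> ?B) x :: real\<bar>" by linarith
      qed
    qed
    then show ?case by simp
  qed
qed

lemma localizing_Un:
  assumes B: "localizing n T B" and C: "localizing n T C"
  shows "localizing n T (B \<union> C)"
  unfolding localizing_def
proof (intro conjI ballI)
  show "B \<union> C \<in> sets (lborel_cube n T)" using B C by (auto simp: localizing_def)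
  fix A assume A: "A \<in> sets (lborel_cube n T)"
  have "(indicator (A \<inter> (B \<union> C)) :: _ \<Rightarrow> real) = (\<lambda>x. indicator (A \<inter> B) x + indicator ((A - B) \<inter> C) x)"
    by (auto simp: indicator_def fun_eq_iff)
  moreover have "A - B \<in> sets (lborel_cube n T)" using A B by (auto simp: localizing_def)
  ultimately show "l2_approximable n T (indicator (A \<inter> (B \<union> C)))"
    using A B C by (auto simp: localizing_def intro!: l2_approximable_add)
qed

lemma localizing_finite_UN:
  "finite I \<Longrightarrow> (\<And>i. i \<in> I \<Longrightarrow> localizing n T (B i)) \<Longrightarrow> localizing n T (\<Union>i\<in>I. B i)"
proof (induction I rule: finite_induct)
  case empty
  then show ?case by (simp add: localizing_def l2_approximable_empty)
qed (simp add: localizing_Un)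

lemma localizing_countable_UN:
  assumes B: "\<And>m::nat. localizing n T (B m)"
  shows "localizing n T (\<Union>m. B m)"
  unfolding localizing_def
proof (intro conjI ballI)
  have Bs: "B m \<in> sets (lborel_cube n T)" for m using B by (auto simp: localizing_def)
  then show "(\<Union>m. B m) \<in> sets (lborel_cube n T)" by auto
  fix A assume A: "A \<in> sets (lborel_cube n T)"
  let ?g = "\<lambda>m. indicator (\<Union>i<m. A \<inter> B i) :: _ \<Rightarrow> real"
  have "l2_approximable n T (indicator (\<Union>m. A \<inter> B m))"
  proof (rule l2_approximable_dominated_limit[where g = ?g])
    show "square_integrable (lborel_cube n T) (indicator (\<Union>m. A \<inter> B m))"
      using A Bs by (intro square_integrable_cube_indicator) auto
    show "l2_approximable n T (?g m)" for m
      using A localizing_finite_UN[of "{..<m}" n T B] B by (auto simp: localizing_def)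
    show "AE x in lborel_cube n T. (\<lambda>m. ?g m x) \<longlonglongrightarrow> indicator (\<Union>m. A \<inter> B m) x"
      by (intro AE_I2 LIMSEQ_indicator_UN)
    show "AE x in lborel_cube n T. \<bar>?g m x\<bar> \<le> 2 * \<bar>indicator (\<Union>m. A \<inter> B m) x :: real\<bar>" for m
      by (intro AE_I2) (auto simp: indicator_def)
  qed
  then show "l2_approximable n T (indicator (A \<inter> (\<Union>m. B m)))" by simp
qed

text \<open>Cells of a regular grid whose indices pairwise differ by at least two are separated; a fine
  enough grid puts a given point off the diagonals into such a cell.\<close>

lemma AE_separated_cover:
  assumes T: "T > 0"
  obtains U where "localizing n T U" "AE x in lborel_cube n T. x \<in> U"
proof -
  define lo where "lo N k i = real (k i) * T / real (Suc N)" for N :: nat and k :: "nat \<Rightarrow> nat" and i :: nat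
  define hi where "hi N k i = real (Suc (k i)) * T / real (Suc N)" for N :: nat and k :: "nat \<Rightarrow> nat" and i :: nat
  define K where "K N = {k \<in> PiE {..<n} (\<lambda>_. {..N}).
     \<forall>i<n. \<forall>j<n. i \<noteq> j \<longrightarrow> Suc (k i) < k j \<or> Suc (k j) < k i}" for N
  define U where "U = (\<Union>N. \<Union>k\<in>K N. half_open_box n (lo N k) (hi N k))"
  have "localizing n T U"
    unfolding U_def
  proof (intro localizing_countable_UN localizing_finite_UN localizing_separated_box)
    show "finite (K N)" for N
      unfolding K_def by (rule finite_subset[of _ "PiE {..<n} (\<lambda>_. {..N})"]) (auto intro: finite_PiE)
    fix N k assume k: "k \<in> K N"
    have less: "hi N k i < lo N k j" if "Suc (k i) < k j" for i j
      using that T unfolding hi_def lo_def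
      by (intro divide_strict_right_mono mult_strict_right_mono) auto
    have "0 \<le> lo N k i \<and> lo N k i \<le> hi N k i \<and> hi N k i \<le> T" if "i < n" for i
    proof (intro conjI)
      show "0 \<le> lo N k i" "lo N k i \<le> hi N k i"
        using T unfolding hi_def lo_def by (auto intro!: divide_right_mono mult_right_mono)
      have "k i \<le> N" using k that by (auto simp: K_def PiE_iff)
      then have "real (Suc (k i)) * T \<le> real (Suc N) * T" using T by (intro mult_right_mono) auto
      then show "hi N k i \<le> T" unfolding hi_def by (simp add: pos_divide_le_eq mult.commute)
    qed
    moreover have "hi N k i < lo N k j \<or> hi N k j < lo N k i" if "i < n" "j < n" "i \<noteq> j" for i j
      using k that less unfolding K_def by blast
    ultimately show "separated_bounds n T (lo N k) (hi N k)"
      unfolding separated_bounds_def by blast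
  qed
  moreover have "AE x in lborel_cube n T. x \<in> U"
    using AE_lborel_cube_off_diagonal[of n T] AE_space[of "lborel_cube n T"]
  proof eventually_elim
    fix x assume off: "(\<forall>i<n. 0 < x i) \<and> (\<forall>i<n. \<forall>j<n. i \<noteq> j \<longrightarrow> x i \<noteq> x j)"
      and sp: "x \<in> space (lborel_cube n T)"
    define D where "D = {\<bar>x i - x j\<bar> | i j. i < n \<and> j < n \<and> i \<noteq> j}"
    have "D \<subseteq> (\<lambda>(i, j). \<bar>x i - x j\<bar>) ` ({..<n} \<times> {..<n})" by (auto simp: D_def)
    then have "finite D" by (rule finite_subset) auto
    define d where "d = Min (insert 1 D)"
    have d: "d > 0" using off \<open>finite D\<close> by (auto simp: d_def D_def)
    have d_le: "d \<le> \<bar>x i - x j\<bar>" if "i < n" "j < n" "i \<noteq> j" for i j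
      unfolding d_def by (rule Min_le) (use \<open>finite D\<close> that in \<open>auto simp: D_def\<close>)
    obtain N :: nat where N: "2 * T / d < real N" using reals_Archimedean2 by blast
    have Nd: "2 * T / real (Suc N) < d"
    proof -
      have "2 * T < real N * d" using N d by (simp add: pos_divide_less_eq)
      also have "\<dots> \<le> real (Suc N) * d" using d by (intro mult_right_mono) auto
      finally show ?thesis by (simp add: pos_divide_less_eq mult.commute)
    qed
    define k where "k = restrict (\<lambda>i. nat (\<lceil>x i * real (Suc N) / T\<rceil> - 1)) {..<n}"
    have mem: "lo N k i < x i \<and> x i \<le> hi N k i \<and> k i \<le> N" if "i < n" for i
    proof -
      let ?y = "x i * real (Suc N) / T"
      have x: "0 < x i" "x i \<le> T" using off sp that by (auto simp: space_lborel_cube PiE_iff)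
      then have "0 < ?y" "?y \<le> real (Suc N)" using T by (auto simp: pos_divide_le_eq)
      then have c: "1 \<le> \<lceil>?y\<rceil>" "\<lceil>?y\<rceil> \<le> int (Suc N)" by (auto simp: ceiling_le_iff)
      then have kr: "real (k i) = real_of_int \<lceil>?y\<rceil> - 1" and "k i \<le> N"
        using that by (auto simp: k_def)
      have "real (k i) < ?y" "?y \<le> real (Suc (k i))" using kr by linarith+
      then have "real (k i) * T < x i * real (Suc N)" "x i * real (Suc N) \<le> real (Suc (k i)) * T"
        using T by (simp_all only: pos_less_divide_eq pos_divide_le_eq)
      then show ?thesis
        using \<open>k i \<le> N\<close> unfolding lo_def hi_def
        by (simp add: pos_divide_less_eq pos_le_divide_eq)
    qed
    have "k \<in> K N"
      unfolding K_def
    proof (intro CollectI conjI allI impI)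
      show "k \<in> PiE {..<n} (\<lambda>_. {..N})" using mem by (auto simp: PiE_iff k_def)
      fix i j assume ij: "i < n" "j < n" "i \<noteq> j"
      have close: "x i - x j < d" if "\<not> Suc (k j) < k i" "i < n" "j < n" for i j
      proof -
        have "x i - x j < hi N k i - lo N k j" using mem[OF that(2)] mem[OF that(3)] by linarith
        also have "\<dots> = (real (Suc (k i)) - real (k j)) * T / real (Suc N)"
          by (simp add: hi_def lo_def diff_divide_distrib[symmetric] left_diff_distrib)
        also have "\<dots> \<le> 2 * T / real (Suc N)"
          using that T by (intro divide_right_mono mult_right_mono) auto
        finally show ?thesis using Nd by linarith
      qed
      show "Suc (k i) < k j \<or> Suc (k j) < k i"
      proof (rule ccontr)
        assume "\<not> (Suc (k i) < k j \<or> Suc (k j) < k i)"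
        then have "x i - x j < d" "x j - x i < d" using close ij by auto
        then show False using d_le[OF ij] by linarith
      qed
    qed
    moreover have "x \<in> half_open_box n (lo N k) (hi N k)"
      using mem sp by (auto simp: half_open_box_def space_lborel_cube PiE_iff)
    ultimately show "x \<in> U" unfolding U_def by blast
  qed
  ultimately show ?thesis by (rule that)
qed

lemma l2_approximable_indicator:
  assumes T: "T > 0" and A: "A \<in> sets (lborel_cube n T)"
  shows "l2_approximable n T (indicator A)"
proof -
  obtain U where U: "localizing n T U" and ae: "AE x in lborel_cube n T. x \<in> U"
    using AE_separated_cover[OF T] by blast
  show ?thesis
  proof (rule l2_approximable_dominated_limit[where g = "\<lambda>_. indicator (A \<inter> U)"])
    show "square_integrable (lborel_cube n T) (indicator A)"
      using A by (rule square_integrable_cube_indicator)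
    show "l2_approximable n T (indicator (A \<inter> U))" using U A by (auto simp: localizing_def)
    show "AE x in lborel_cube n T. (\<lambda>m. indicator (A \<inter> U) x :: real) \<longlonglongrightarrow> indicator A x"
      using ae by eventually_elim (simp add: indicator_def)
  qed (auto simp: indicator_def)
qed

text \<open>Simple functions reduce the claim to indicators. The functions \<open>s'\<close> in the proof agree with
  the simple functions \<open>s\<close> on the cube but are sums over their level sets everywhere.\<close>

theorem step_functions_dense:
  assumes T: "T > 0" and f: "square_integrable (lborel_cube n T) f" and \<delta>: "\<delta> > 0"
  obtains e where "e \<in> step_functions n T" "(LINT x|lborel_cube n T. (f x - e x)\<^sup>2) < \<delta>"
proof -
  have fm: "f \<in> borel_measurable (lborel_cube n T)" using f by (simp add: square_integrable_def)
  obtain s where s: "\<And>i. simple_function (lborel_cube n T) (s i)"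
    "\<And>x. x \<in> space (lborel_cube n T) \<Longrightarrow> (\<lambda>i. s i x) \<longlonglongrightarrow> f x"
    "\<And>i x. x \<in> space (lborel_cube n T) \<Longrightarrow> dist (s i x) 0 \<le> 2 * dist (f x) 0"
    using borel_measurable_implies_sequence_metric[OF fm, of 0] by blast
  let ?Om = "space (lborel_cube n T)"
  define s' where "s' i x = (\<Sum>y\<in>s i ` ?Om. y * indicator (s i -` {y} \<inter> ?Om) x)" for i x
  have s': "s' i x = s i x" if "x \<in> ?Om" for i x
  proof -
    have "s' i x = (\<Sum>y\<in>s i ` ?Om. if y = s i x then y else 0)"
      unfolding s'_def using that by (intro sum.cong) (auto simp: indicator_def)
    also have "\<dots> = s i x" using simple_functionD(1)[OF s(1)] that by simp
    finally show ?thesis .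
  qed
  have "l2_approximable n T f"
  proof (rule l2_approximable_dominated_limit[OF f, where g = s'])
    show "l2_approximable n T (s' i)" for i
      unfolding s'_def using simple_functionD[OF s(1)]
      by (intro l2_approximable_sum l2_approximable_scale l2_approximable_indicator T) auto
    show "AE x in lborel_cube n T. (\<lambda>m. s' m x) \<longlonglongrightarrow> f x"
      by (intro AE_I2) (simp add: s' s(2))
    show "AE x in lborel_cube n T. \<bar>s' m x\<bar> \<le> 2 * \<bar>f x\<bar>" for m
      using s(3) by (intro AE_I2) (simp add: s')
  qed
  then show ?thesis using \<delta> that unfolding l2_approximable_def by blast
qed

section \<open>Pairing with a product of one-variable functions\<close>

lemma cauchy_schwarz_integral:
  assumes f: "square_integrable M f" and g: "square_integrable M g"
  shows "(LINT x|M. \<bar>f x * g x\<bar>)\<^sup>2 \<le> (LINT x|M. (f x)\<^sup>2) * (LINT x|M. (g x)\<^sup>2)"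
proof -
  have [measurable]: "f \<in> borel_measurable M" "g \<in> borel_measurable M"
    using f g by (auto simp: square_integrable_def)
  have sq: "(\<integral>\<^sup>+x. (ennreal \<bar>u x\<bar>)\<^sup>2 \<partial>M) = ennreal (LINT x|M. (u x)\<^sup>2)" if "square_integrable M u" for u
    using that by (subst nn_integral_eq_integral[symmetric])
      (auto simp: square_integrable_def ennreal_power)
  have "(\<integral>\<^sup>+x. ennreal \<bar>f x\<bar> * ennreal \<bar>g x\<bar> \<partial>M) = ennreal (LINT x|M. \<bar>f x * g x\<bar>)"
    using nn_integral_eq_integral[OF integrable_abs[OF square_integrable_mult_integrable[OF f g]]]
    by (simp add: ennreal_mult abs_mult)
  then have "ennreal ((LINT x|M. \<bar>f x * g x\<bar>)\<^sup>2) \<le> ennreal ((LINT x|M. (f x)\<^sup>2) * (LINT x|M. (g x)\<^sup>2))"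
    using Cauchy_Schwarz_nn_integral[of "\<lambda>x. ennreal \<bar>f x\<bar>" M "\<lambda>x. ennreal \<bar>g x\<bar>"] sq[OF f] sq[OF g]
    by (simp add: ennreal_power ennreal_mult)
  then show ?thesis by (simp add: ennreal_le_iff)
qed

definition product_pairing :: "nat \<Rightarrow> real \<Rightarrow> ((nat \<Rightarrow> real) \<Rightarrow> real) \<Rightarrow> (real \<Rightarrow> real) \<Rightarrow> real" where
  "product_pairing n T F h = (LINT x|lborel_cube n T. F x * (\<Prod>i<n. h (x i)))"

abbreviation (input) primitive :: "(real \<Rightarrow> real) \<Rightarrow> real \<Rightarrow> real" where
  "primitive h t \<equiv> (LINT s:{0..t}|lborel. h s)"

lemma square_integrable_tensor_power:
  assumes h: "square_integrable (restrict_space lborel {0..T}) h"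
  shows "square_integrable (lborel_cube n T) (\<lambda>x. \<Prod>i<n. h (x i))"
proof -
  interpret product_sigma_finite "\<lambda>_::nat. restrict_space lborel {0..T}"
    by (rule product_sigma_finite_interval)
  have "h \<in> borel_measurable (restrict_space lborel {0..T})"
    using h by (simp add: square_integrable_def)
  then have "(\<lambda>x. h (x i)) \<in> borel_measurable (lborel_cube n T)" if "i < n" for i
    unfolding lborel_cube_def
    using that by (intro measurable_compose[OF measurable_component_singleton]) auto
  then have "(\<lambda>x. \<Prod>i<n. h (x i)) \<in> borel_measurable (lborel_cube n T)"
    by (intro borel_measurable_prod) auto
  moreover have "integrable (lborel_cube n T) (\<lambda>x. \<Prod>i<n. (h (x i))\<^sup>2)"
    unfolding lborel_cube_def
    by (rule product_integrable_prod) (use h in \<open>auto simp: square_integrable_def\<close>)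
  ultimately show ?thesis by (simp add: square_integrable_def prod_power_distrib)
qed

lemma product_pairing_integrable:
  assumes "square_integrable (lborel_cube n T) F" "square_integrable (restrict_space lborel {0..T}) h"
  shows "integrable (lborel_cube n T) (\<lambda>x. F x * (\<Prod>i<n. h (x i)))"
  by (intro square_integrable_mult_integrable square_integrable_tensor_power assms)

lemma product_pairing_add:
  assumes "square_integrable (lborel_cube n T) F" "square_integrable (lborel_cube n T) G"
    "square_integrable (restrict_space lborel {0..T}) h"
  shows "product_pairing n T (\<lambda>x. F x + G x) h = product_pairing n T F h + product_pairing n T G h"
  using product_pairing_integrable[OF assms(1,3)] product_pairing_integrable[OF assms(2,3)]
  by (simp add: product_pairing_def distrib_right)

lemma product_pairing_scale:
  "product_pairing n T (\<lambda>x. c * F x) h = c * product_pairing n T F h"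
  by (simp add: product_pairing_def mult.assoc)

lemma product_pairing_diff:
  assumes F: "square_integrable (lborel_cube n T) F" and G: "square_integrable (lborel_cube n T) G"
    and h: "square_integrable (restrict_space lborel {0..T}) h"
  shows "product_pairing n T (\<lambda>x. F x - G x) h = product_pairing n T F h - product_pairing n T G h"
  using product_pairing_add[OF F square_integrable_scale[OF G, of "-1"] h]
    product_pairing_scale[of n T "-1" G h] by simp

text \<open>Only increments of the primitive of \<open>h\<close> enter the pairing with a box, because the integral
  over a box factors.\<close>

lemma integral_half_open_eq_primitive_diff:
  assumes h: "square_integrable (restrict_space lborel {0..T}) h" and ab: "0 \<le> a" "a \<le> b" "b \<le> T"
  shows "integrable (restrict_space lborel {0..T}) (\<lambda>u. indicator {a<..b} u * h u)"
    and "(LINT u|restrict_space lborel {0..T}. indicator {a<..b} u * h u) = primitive h b - primitive h a"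
proof -
  let ?L = "restrict_space lborel {0..T}"
  have ind: "square_integrable ?L (indicator A)" if "A \<in> sets borel" for A
    using that by (intro finite_measure.square_integrable_indicator finite_measure_interval)
      (auto simp: sets_restrict_space_iff)
  have int: "integrable ?L (\<lambda>u. indicator A u * h u)" if "A \<in> sets borel" for A
    by (rule square_integrable_mult_integrable[OF ind[OF that] h])
  show "integrable ?L (\<lambda>u. indicator {a<..b} u * h u)" by (rule int) simp
  have prim: "(LINT u|?L. indicator {0..c} u * h u) = primitive h c" if "c \<le> T" for c
    unfolding set_lebesgue_integral_def
    using that by (subst integral_restrict_space) (auto intro!: Bochner_Integration.integral_cong simp: indicator_def)
  have "(LINT u|?L. indicator {0..b} u * h u) =
      (LINT u|?L. indicator {0..a} u * h u + indicator {a<..b} u * h u)"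
    using ab by (intro Bochner_Integration.integral_cong) (auto simp: indicator_def)
  also have "\<dots> = (LINT u|?L. indicator {0..a} u * h u) + (LINT u|?L. indicator {a<..b} u * h u)"
    by (intro Bochner_Integration.integral_add int) auto
  finally show "(LINT u|?L. indicator {a<..b} u * h u) = primitive h b - primitive h a"
    using ab by (simp add: prim)
qed

lemma product_pairing_box:
  assumes h: "square_integrable (restrict_space lborel {0..T}) h"
    and ab: "\<And>i. i < n \<Longrightarrow> 0 \<le> a i \<and> a i \<le> b i \<and> b i \<le> T"
  shows "product_pairing n T (indicator (half_open_box n a b)) h
    = (\<Prod>i<n. primitive h (b i) - primitive h (a i))"
proof -
  interpret product_sigma_finite "\<lambda>_::nat. restrict_space lborel {0..T}"
    by (rule product_sigma_finite_interval)
  have ind: "indicator (half_open_box n a b) x = (\<Prod>i<n. indicator {a i<..b i} (x i) :: real)"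
    if sp: "x \<in> space (lborel_cube n T)" for x
  proof (cases "x \<in> half_open_box n a b")
    case True
    then show ?thesis by (auto simp: half_open_box_def PiE_iff intro!: prod.neutral[symmetric])
  next
    case False
    then obtain i where "i < n" "x i \<notin> {a i<..b i}"
      using sp by (auto simp: half_open_box_def space_lborel_cube PiE_iff)
    then have "(\<Prod>i<n. indicator {a i<..b i} (x i) :: real) = 0"
      by (intro prod_zero) (auto intro!: bexI[of _ i])
    then show ?thesis using False by simp
  qed
  have "product_pairing n T (indicator (half_open_box n a b)) h
      = (LINT x|lborel_cube n T. (\<Prod>i<n. indicator {a i<..b i} (x i) * h (x i)))"
    unfolding product_pairing_def
    by (intro Bochner_Integration.integral_cong) (auto simp: ind prod.distrib)
  also have "\<dots> = (\<Prod>i<n. (LINT u|restrict_space lborel {0..T}. indicator {a i<..b i} u * h u))"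
    unfolding lborel_cube_def
    by (rule product_integral_prod) (use integral_half_open_eq_primitive_diff(1)[OF h] ab in auto)
  also have "\<dots> = (\<Prod>i<n. primitive h (b i) - primitive h (a i))"
    using integral_half_open_eq_primitive_diff(2)[OF h] ab by (intro prod.cong) auto
  finally show ?thesis .
qed

text \<open>Cauchy-Schwarz against the tensor power of \<open>h\<close>, whose norm is finite because \<open>h\<close> is
  square-integrable.\<close>

lemma product_pairing_tendsto:
  assumes F: "square_integrable (lborel_cube n T) F" and G: "\<And>m. square_integrable (lborel_cube n T) (G m)"
    and h: "square_integrable (restrict_space lborel {0..T}) h"
    and lim: "(\<lambda>m. LINT x|lborel_cube n T. (F x - G m x)\<^sup>2) \<longlonglongrightarrow> 0"
  shows "(\<lambda>m. product_pairing n T (G m) h) \<longlonglongrightarrow> product_pairing n T F h"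
proof -
  define c where "c = (LINT x|lborel_cube n T. (\<Prod>i<n. h (x i))\<^sup>2)"
  have "(\<lambda>m. product_pairing n T F h - product_pairing n T (G m) h) \<longlonglongrightarrow> 0"
  proof (rule Lim_null_comparison)
    show "eventually (\<lambda>m. norm (product_pairing n T F h - product_pairing n T (G m) h) \<le>
      sqrt ((LINT x|lborel_cube n T. (F x - G m x)\<^sup>2) * c)) sequentially"
    proof (intro always_eventually allI)
      fix m
      have d: "square_integrable (lborel_cube n T) (\<lambda>x. F x - G m x)"
        by (rule square_integrable_diff[OF F G])
      have "\<bar>product_pairing n T (\<lambda>x. F x - G m x) h\<bar> \<le>
          (LINT x|lborel_cube n T. \<bar>(F x - G m x) * (\<Prod>i<n. h (x i))\<bar>)"
        unfolding product_pairing_def by (rule integral_abs_bound)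
      also have "\<dots> \<le> sqrt ((LINT x|lborel_cube n T. (F x - G m x)\<^sup>2) * c)"
        unfolding c_def
        by (intro real_le_rsqrt cauchy_schwarz_integral d square_integrable_tensor_power h)
      finally show "norm (product_pairing n T F h - product_pairing n T (G m) h) \<le>
          sqrt ((LINT x|lborel_cube n T. (F x - G m x)\<^sup>2) * c)"
        by (simp add: product_pairing_diff[OF F G h])
    qed
    have "(\<lambda>m. sqrt ((LINT x|lborel_cube n T. (F x - G m x)\<^sup>2) * c)) \<longlonglongrightarrow> sqrt (0 * c)"
      by (intro tendsto_intros lim)
    then show "(\<lambda>m. sqrt ((LINT x|lborel_cube n T. (F x - G m x)\<^sup>2) * c)) \<longlonglongrightarrow> 0" by simp
  qed
  from tendsto_diff[OF tendsto_const[of "product_pairing n T F h"] this] show ?thesis by simp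
qed

text \<open>Only the primitives of the random functions are assumed to be random variables. On step
  functions the pairing is a polynomial in values of the primitive, and along an $L^2$-approximation
  by step functions it converges for every outcome.\<close>

lemma product_pairing_measurable:
  assumes T: "T > 0" and F: "square_integrable (lborel_cube n T) F"
    and h: "\<And>\<omega>. \<omega> \<in> space M \<Longrightarrow> square_integrable (restrict_space lborel {0..T}) (h \<omega>)"
    and meas: "\<And>s. s \<in> {0..T} \<Longrightarrow> (\<lambda>\<omega>. primitive (h \<omega>) s) \<in> borel_measurable M"
  shows "(\<lambda>\<omega>. product_pairing n T F (h \<omega>)) \<in> borel_measurable M"
proof -
  have step: "(\<lambda>\<omega>. product_pairing n T e (h \<omega>)) \<in> borel_measurable M" if "e \<in> step_functions n T" for e
    using that
  proof (induction rule: step_functions.induct)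
    case zero
    then show ?case by (simp add: product_pairing_def)
  next
    case (box a b)
    then have ab: "\<And>i. i < n \<Longrightarrow> 0 \<le> a i \<and> a i \<le> b i \<and> b i \<le> T"
      by (auto simp: separated_bounds_def)
    have "(\<lambda>\<omega>. \<Prod>i<n. primitive (h \<omega>) (b i) - primitive (h \<omega>) (a i)) \<in> borel_measurable M"
      using ab by (intro borel_measurable_prod borel_measurable_diff meas) force+
    then show ?case
      by (rule measurable_cong[THEN iffD1, rotated]) (simp add: product_pairing_box[OF h ab])
  next
    case (add e e')
    have "(\<lambda>\<omega>. product_pairing n T e (h \<omega>) + product_pairing n T e' (h \<omega>)) \<in> borel_measurable M"
      using add.IH by (rule borel_measurable_add)
    then show ?case
      by (rule measurable_cong[THEN iffD1, rotated])
         (simp add: product_pairing_add[OF square_integrable_step square_integrable_step h] add.hyps)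
  next
    case (scale e c)
    then show ?case by (simp add: product_pairing_scale)
  qed
  have "\<exists>e\<in>step_functions n T. (LINT x|lborel_cube n T. (F x - e x)\<^sup>2) < 1 / real (Suc m)" for m
    using step_functions_dense[OF T F, of "1 / real (Suc m)"] by (auto simp: divide_pos_pos)
  then obtain e where e: "\<And>m. e m \<in> step_functions n T"
    "\<And>m. (LINT x|lborel_cube n T. (F x - e m x)\<^sup>2) < 1 / real (Suc m)"
    by metis
  have lim: "(\<lambda>m. LINT x|lborel_cube n T. (F x - e m x)\<^sup>2) \<longlonglongrightarrow> 0"
    by (rule tendsto_sandwich[OF _ _ tendsto_const LIMSEQ_Suc[OF lim_1_over_n]])
       (use e(2) in \<open>auto intro!: always_eventually less_imp_le\<close>)
  show ?thesis
  proof (rule borel_measurable_LIMSEQ_real)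
    show "(\<lambda>\<omega>. product_pairing n T (e m) (h \<omega>)) \<in> borel_measurable M" for m
      by (rule step[OF e(1)])
    show "(\<lambda>m. product_pairing n T (e m) (h \<omega>)) \<longlonglongrightarrow> product_pairing n T F (h \<omega>)"
      if "\<omega> \<in> space M" for \<omega>
      by (rule product_pairing_tendsto[OF F square_integrable_step[OF e(1)] h[OF that] lim])
  qed
qed

section \<open>The off-diagonal integral as a pairing\<close>

definition off_diagonal_cutoff :: "nat \<Rightarrow> real \<Rightarrow> (nat \<Rightarrow> real) \<Rightarrow> real" where
  "off_diagonal_cutoff n \<epsilon> x =
     (\<Prod>(i, j)\<in>{(i, j). i < n \<and> j < n \<and> i \<noteq> j}. indicator {\<epsilon><..} \<bar>x i - x j\<bar>)"

lemma finite_distinct_pairs: "finite {(i::nat, j). i < n \<and> j < n \<and> i \<noteq> j}"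
  by (rule finite_subset[of _ "{..<n} \<times> {..<n}"]) auto

lemma off_diagonal_cutoff_measurable: "off_diagonal_cutoff n \<epsilon> \<in> borel_measurable (lborel_cube n T)"
  unfolding off_diagonal_cutoff_def[abs_def] case_prod_beta
proof (rule borel_measurable_prod)
  fix p assume "p \<in> {p. fst p < n \<and> snd p < n \<and> fst p \<noteq> snd p}"
  then have [measurable]: "(\<lambda>x. x (fst p)) \<in> borel_measurable (lborel_cube n T)"
    "(\<lambda>x. x (snd p)) \<in> borel_measurable (lborel_cube n T)"
    by (auto intro!: coordinate_measurable)
  show "(\<lambda>x. indicat_real {\<epsilon><..} \<bar>x (fst p) - x (snd p)\<bar>) \<in> borel_measurable (lborel_cube n T)"
    by measurable
qed

lemma off_diagonal_cutoff_bounds: "0 \<le> off_diagonal_cutoff n \<epsilon> x" "off_diagonal_cutoff n \<epsilon> x \<le> 1"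
  unfolding off_diagonal_cutoff_def
  by (auto intro!: prod_nonneg prod_le_1 simp: indicator_def split: prod.split)

definition truncation :: "nat \<Rightarrow> real \<Rightarrow> real \<Rightarrow> ((nat \<Rightarrow> real) \<Rightarrow> real) \<Rightarrow> (nat \<Rightarrow> real) \<Rightarrow> real" where
  "truncation n \<epsilon> t f x = f x * (indicator (PiE {..<n} (\<lambda>_. {0..t})) x * off_diagonal_cutoff n \<epsilon> x)"

lemma off_diagonal_integral_eq_pairing:
  "off_diagonal_integral n T \<epsilon> f h t = product_pairing n T (truncation n \<epsilon> t f) h"
  unfolding off_diagonal_integral_def product_pairing_def set_lebesgue_integral_def
    truncation_def off_diagonal_cutoff_def
  by (intro Bochner_Integration.integral_cong) (auto simp: indicator_def)

lemma cube_in_sets: "t \<le> T \<Longrightarrow> PiE {..<n} (\<lambda>_. {0..t}) \<in> sets (lborel_cube n T)"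
  by (rule PiE_in_sets_lborel_cube) auto

lemma square_integrable_truncation:
  assumes f: "square_integrable (lborel_cube n T) f" and t: "t \<le> T"
  shows "square_integrable (lborel_cube n T) (truncation n \<epsilon> t f)"
proof (rule square_integrable_bound[OF f])
  show "truncation n \<epsilon> t f \<in> borel_measurable (lborel_cube n T)"
    unfolding truncation_def[abs_def] using f cube_in_sets[OF t] off_diagonal_cutoff_measurable
    by (auto simp: square_integrable_def)
  show "\<bar>truncation n \<epsilon> t f x\<bar> \<le> \<bar>f x\<bar>" for x
  proof -
    have "\<bar>indicator (PiE {..<n} (\<lambda>_. {0..t})) x * off_diagonal_cutoff n \<epsilon> x\<bar> \<le> 1"
      using off_diagonal_cutoff_bounds[of n \<epsilon> x] by (cases "x \<in> PiE {..<n} (\<lambda>_. {0..t})") simp_all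
    then show ?thesis
      unfolding truncation_def abs_mult[of "f x"] by (intro mult_left_le) simp_all
  qed
qed

lemma off_diagonal_integral_add:
  assumes "square_integrable (lborel_cube n T) f" "square_integrable (lborel_cube n T) g"
    "square_integrable (restrict_space lborel {0..T}) h" "t \<le> T"
  shows "off_diagonal_integral n T \<epsilon> (\<lambda>x. f x + g x) h t
    = off_diagonal_integral n T \<epsilon> f h t + off_diagonal_integral n T \<epsilon> g h t"
proof -
  have "truncation n \<epsilon> t (\<lambda>x. f x + g x) = (\<lambda>x. truncation n \<epsilon> t f x + truncation n \<epsilon> t g x)"
    by (rule ext) (simp only: truncation_def distrib_right)
  then show ?thesis
    unfolding off_diagonal_integral_eq_pairing
    using product_pairing_add[OF square_integrable_truncation[OF assms(1,4)]
      square_integrable_truncation[OF assms(2,4)] assms(3)] by (simp only:)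
qed

lemma off_diagonal_integral_scale:
  "off_diagonal_integral n T \<epsilon> (\<lambda>x. c * f x) h t = c * off_diagonal_integral n T \<epsilon> f h t"
proof -
  have "truncation n \<epsilon> t (\<lambda>x. c * f x) = (\<lambda>x. c * truncation n \<epsilon> t f x)"
    by (rule ext) (simp only: truncation_def mult.assoc)
  then show ?thesis
    unfolding off_diagonal_integral_eq_pairing by (simp only: product_pairing_scale)
qed

lemma off_diagonal_integral_diff:
  assumes "square_integrable (lborel_cube n T) f" "square_integrable (lborel_cube n T) g"
    "square_integrable (restrict_space lborel {0..T}) h" "t \<le> T"
  shows "off_diagonal_integral n T \<epsilon> (\<lambda>x. f x - g x) h t
    = off_diagonal_integral n T \<epsilon> f h t - off_diagonal_integral n T \<epsilon> g h t"
  using off_diagonal_integral_add[OF assms(1) square_integrable_scale[OF assms(2), of "-1"] assms(3,4), of \<epsilon>]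
    off_diagonal_integral_scale[of n T \<epsilon> "-1" g h t] by simp

lemma half_open_box_Int_cube:
  assumes "\<And>i. i < n \<Longrightarrow> 0 \<le> a i"
  shows "half_open_box n a b \<inter> PiE {..<n} (\<lambda>_. {0..t})
    = half_open_box n (\<lambda>i. min (a i) t) (\<lambda>i. min (b i) t)"
  unfolding half_open_box_def PiE_Int
proof (rule PiE_cong)
  fix i assume "i \<in> {..<n}"
  then have "0 \<le> a i" using assms by simp
  then show "{a i<..b i} \<inter> {0..t} = {min (a i) t<..min (b i) t}" by (auto simp: min_def)
qed

lemma indicator_box_mult_cube:
  assumes "\<And>i. i < n \<Longrightarrow> 0 \<le> a i"
  shows "(indicator (half_open_box n a b) x * indicator (PiE {..<n} (\<lambda>_. {0..t})) x :: real)
    = indicator (half_open_box n (\<lambda>i. min (a i) t) (\<lambda>i. min (b i) t)) x"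
  by (subst half_open_box_Int_cube[OF assms, symmetric]) (simp_all only: indicator_inter_arith)

text \<open>The threshold is the smallest distance between two sides of the box; the maximum of
  \<open>a j - b i\<close> and \<open>a i - b j\<close> is the distance between the sides \<open>i\<close> and \<open>j\<close>. The number 1 only keeps
  the minimum defined when there is just one side.\<close>

lemma off_diagonal_cutoff_box:
  assumes sep: "separated_bounds n T a b"
  obtains \<epsilon>0 where "\<epsilon>0 > 0"
    "\<And>\<epsilon> x. \<epsilon> < \<epsilon>0 \<Longrightarrow> x \<in> half_open_box n a b \<Longrightarrow> off_diagonal_cutoff n \<epsilon> x = 1"
proof -
  let ?P = "{(i, j). i < n \<and> j < n \<and> i \<noteq> j}"
  define d where "d p = (case p of (i, j) \<Rightarrow> max (a j - b i) (a i - b j))" for p :: "nat \<times> nat"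
  define \<epsilon>0 where "\<epsilon>0 = Min (insert 1 (d ` ?P))"
  have fin: "finite (insert 1 (d ` ?P))" using finite_distinct_pairs[of n] by simp
  have "\<epsilon>0 > 0"
    unfolding \<epsilon>0_def using fin sep
    by (subst Min_gr_iff) (auto simp: d_def separated_bounds_def less_max_iff_disj)
  moreover have "off_diagonal_cutoff n \<epsilon> x = 1" if "\<epsilon> < \<epsilon>0" "x \<in> half_open_box n a b" for \<epsilon> x
    unfolding off_diagonal_cutoff_def
  proof (intro prod.neutral ballI)
    fix p assume p: "p \<in> ?P"
    obtain i j where ij: "p = (i, j)" "i < n" "j < n" "i \<noteq> j" using p by auto
    have "\<epsilon>0 \<le> d p" unfolding \<epsilon>0_def using fin p by (intro Min_le) auto
    moreover have "a i < x i" "x i \<le> b i" "a j < x j" "x j \<le> b j"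
      using that(2) ij by (auto simp: half_open_box_def PiE_iff)
    ultimately have "\<epsilon> < \<bar>x i - x j\<bar>" using that(1) by (auto simp: d_def ij max_def split: if_splits)
    then show "(case p of (i, j) \<Rightarrow> indicat_real {\<epsilon><..} \<bar>x i - x j\<bar>) = 1" by (simp add: ij)
  qed
  ultimately show ?thesis by (rule that)
qed

text \<open>Intersecting the box with $[0,t]^n$ clips its sides at \<open>t\<close>, and below the threshold the
  cutoff is inactive; what remains is the pairing with a box.\<close>

lemma off_diagonal_integral_box:
  assumes sep: "separated_bounds n T a b" and t: "t \<in> {0..T}"
  obtains \<epsilon>0 where "\<epsilon>0 > 0"
    "\<And>\<epsilon> h. \<epsilon> < \<epsilon>0 \<Longrightarrow> square_integrable (restrict_space lborel {0..T}) h \<Longrightarrow>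
      off_diagonal_integral n T \<epsilon> (indicator (half_open_box n a b)) h t
        = (\<Prod>i<n. primitive h (min (b i) t) - primitive h (min (a i) t))"
proof -
  obtain \<epsilon>0 where \<epsilon>0: "\<epsilon>0 > 0"
    "\<And>\<epsilon> x. \<epsilon> < \<epsilon>0 \<Longrightarrow> x \<in> half_open_box n a b \<Longrightarrow> off_diagonal_cutoff n \<epsilon> x = 1"
    using off_diagonal_cutoff_box[OF sep] by blast
  have ab: "\<And>i. i < n \<Longrightarrow> 0 \<le> a i \<and> a i \<le> b i \<and> b i \<le> T" using sep by (auto simp: separated_bounds_def)
  have ab': "0 \<le> min (a i) t \<and> min (a i) t \<le> min (b i) t \<and> min (b i) t \<le> T" if "i < n" for i
    using ab[OF that] t by auto
  have "off_diagonal_integral n T \<epsilon> (indicator (half_open_box n a b)) h t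
        = (\<Prod>i<n. primitive h (min (b i) t) - primitive h (min (a i) t))"
    if "\<epsilon> < \<epsilon>0" and h: "square_integrable (restrict_space lborel {0..T}) h" for \<epsilon> h
  proof -
    have "truncation n \<epsilon> t (indicator (half_open_box n a b)) x
        = indicator (half_open_box n (\<lambda>i. min (a i) t) (\<lambda>i. min (b i) t)) x" for x
    proof -
      have "truncation n \<epsilon> t (indicator (half_open_box n a b)) x
        = indicator (half_open_box n a b) x * indicator (PiE {..<n} (\<lambda>_. {0..t})) x"
        using \<epsilon>0(2)[OF that(1), of x] by (auto simp: truncation_def indicator_def)
      then show ?thesis using indicator_box_mult_cube[of n a b x t] ab by simp
    qed
    then have "truncation n \<epsilon> t (indicator (half_open_box n a b))
        = indicator (half_open_box n (\<lambda>i. min (a i) t) (\<lambda>i. min (b i) t))" by (rule ext)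
    then show ?thesis
      unfolding off_diagonal_integral_eq_pairing
      using product_pairing_box[OF h ab'] by simp
  qed
  with \<epsilon>0(1) show ?thesis by (rule that)
qed

section \<open>Multiple integrals of step functions\<close>

lemma multiple_wiener_ito_integral_zero:
  assumes "multiple_wiener_ito_integral n T N W I"
  shows "AE \<omega> in N. I (\<lambda>x. 0) \<omega> = 0"
proof -
  have "\<forall>c f. square_integrable (lborel_cube n T) f \<longrightarrow> (AE \<omega> in N. I (\<lambda>x. c * f x) \<omega> = c * I f \<omega>)"
    using assms unfolding multiple_wiener_ito_integral_def by blast
  from this[rule_format, of "\<lambda>_. 0" 0] show ?thesis by (simp add: square_integrable_zero)
qed

text \<open>Clipping at \<open>t\<close> produces boxes with empty sides. For these both the indicator and the
  product of increments vanish.\<close>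

lemma multiple_wiener_ito_integral_box:
  assumes I: "multiple_wiener_ito_integral n T N W I"
    and ab: "\<And>i. i < n \<Longrightarrow> 0 \<le> a i \<and> a i \<le> b i \<and> b i \<le> T"
    and disj: "disjoint_family_on (\<lambda>i. {a i<..b i}) {..<n}"
  shows "AE \<omega> in N. I (indicator (half_open_box n a b)) \<omega> = (\<Prod>i<n. W (b i) \<omega> - W (a i) \<omega>)"
proof (cases "\<forall>i<n. a i < b i")
  case True
  with ab have "\<forall>i<n. 0 \<le> a i \<and> a i < b i \<and> b i \<le> T" by blast
  then show ?thesis
    using I disj unfolding multiple_wiener_ito_integral_def half_open_box_def by blast
next
  case False
  then obtain i where i: "i < n" "a i = b i" using ab by (metis less_eq_real_def)
  then have "half_open_box n a b = {}" by (auto simp: half_open_box_def PiE_eq_empty_iff)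
  then have "(indicator (half_open_box n a b) :: _ \<Rightarrow> real) = (\<lambda>x. 0)" by auto
  moreover have "(\<Prod>i<n. W (b i) \<omega> - W (a i) \<omega>) = 0" for \<omega>
    using i by (intro prod_zero) (auto intro!: bexI[of _ i])
  ultimately show ?thesis using multiple_wiener_ito_integral_zero[OF I] by (simp only:)
qed

text \<open>The link between the two sides: for a step function, the off-diagonal integral (once
  \<open>\<epsilon>\<close> is below the distance from the support to the diagonals) and the multiple integral
  are the same continuous function of finitely many values of the respective path.\<close>

lemma step_function_representation:
  assumes I: "multiple_wiener_ito_integral n T N W I" and t: "t \<in> {0..T}"
    and e: "e \<in> step_functions n T"
  shows "\<exists>F P \<epsilon>0. finite F \<and> F \<subseteq> {0..T} \<and> continuous_on UNIV (P :: (real \<Rightarrow> real) \<Rightarrow> real) \<and>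
    (\<forall>p q. (\<forall>s\<in>F. p s = q s) \<longrightarrow> P p = P q) \<and> \<epsilon>0 > 0 \<and>
    (\<forall>\<epsilon> h. \<epsilon> < \<epsilon>0 \<longrightarrow> square_integrable (restrict_space lborel {0..T}) h \<longrightarrow>
       off_diagonal_integral n T \<epsilon> e h t = P (primitive h)) \<and>
    (AE \<omega> in N. I (\<lambda>x. e x * indicator (PiE {..<n} (\<lambda>_. {0..t})) x) \<omega> = P (\<lambda>s. W s \<omega>))"
  using e
proof (induction rule: step_functions.induct)
  case zero
  show ?case
    using multiple_wiener_ito_integral_zero[OF I]
    by (intro exI[of _ "{}"] exI[of _ "\<lambda>_. 0"] exI[of _ 1])
       (simp add: off_diagonal_integral_eq_pairing product_pairing_def truncation_def)
next
  case (box a b)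
  then have ab: "\<And>i. i < n \<Longrightarrow> 0 \<le> a i \<and> a i \<le> b i \<and> b i \<le> T" by (auto simp: separated_bounds_def)
  obtain \<epsilon>0 where \<epsilon>0: "\<epsilon>0 > 0"
    "\<And>\<epsilon> h. \<epsilon> < \<epsilon>0 \<Longrightarrow> square_integrable (restrict_space lborel {0..T}) h \<Longrightarrow>
      off_diagonal_integral n T \<epsilon> (indicator (half_open_box n a b)) h t
        = (\<Prod>i<n. primitive h (min (b i) t) - primitive h (min (a i) t))"
    using off_diagonal_integral_box[OF box t] by blast
  let ?F = "(\<lambda>i. min (a i) t) ` {..<n} \<union> (\<lambda>i. min (b i) t) ` {..<n}"
  let ?P = "\<lambda>p :: real \<Rightarrow> real. \<Prod>i<n. p (min (b i) t) - p (min (a i) t)"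
  have "?F \<subseteq> {0..T}" using ab t by (force simp: min_def)
  moreover have "continuous_on UNIV ?P"
    by (intro continuous_on_prod continuous_on_diff continuous_on_product_coordinates)
  moreover have "\<forall>p q. (\<forall>s\<in>?F. p s = q s) \<longrightarrow> ?P p = ?P q"
    by (auto intro!: prod.cong)
  moreover have "AE \<omega> in N. I (\<lambda>x. indicator (half_open_box n a b) x * indicator (PiE {..<n} (\<lambda>_. {0..t})) x) \<omega>
      = ?P (\<lambda>s. W s \<omega>)"
  proof -
    have "disjoint_family_on (\<lambda>i. {min (a i) t<..min (b i) t}) {..<n}"
      unfolding disjoint_family_on_def
    proof (intro ballI impI)
      fix i j assume "i \<in> {..<n}" "j \<in> {..<n}" "i \<noteq> j"
      then have "b i < a j \<or> b j < a i" using box by (auto simp: separated_bounds_def)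
      then show "{min (a i) t<..min (b i) t} \<inter> {min (a j) t<..min (b j) t} = {}" by auto
    qed
    moreover have "0 \<le> min (a i) t \<and> min (a i) t \<le> min (b i) t \<and> min (b i) t \<le> T" if "i < n" for i
      using ab[OF that] t by auto
    ultimately have "AE \<omega> in N. I (indicator (half_open_box n (\<lambda>i. min (a i) t) (\<lambda>i. min (b i) t))) \<omega>
        = ?P (\<lambda>s. W s \<omega>)"
      by (intro multiple_wiener_ito_integral_box[OF I])
    moreover have "(\<lambda>x. indicat_real (half_open_box n a b) x * indicator (PiE {..<n} (\<lambda>_. {0..t})) x)
        = indicator (half_open_box n (\<lambda>i. min (a i) t) (\<lambda>i. min (b i) t))"
      by (rule ext, rule indicator_box_mult_cube) (use ab in auto)
    ultimately show ?thesis by simp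
  qed
  ultimately show ?case using \<epsilon>0
    by (intro exI[of _ ?F] exI[of _ ?P] exI[of _ \<epsilon>0]) simp
next
  case (add e e')
  obtain F P \<epsilon>0 where 1: "finite F" "F \<subseteq> {0..T}" "continuous_on UNIV P"
    "\<forall>p q. (\<forall>s\<in>F. p s = q s) \<longrightarrow> P p = P q" "\<epsilon>0 > 0"
    "\<forall>\<epsilon> h. \<epsilon> < \<epsilon>0 \<longrightarrow> square_integrable (restrict_space lborel {0..T}) h \<longrightarrow>
       off_diagonal_integral n T \<epsilon> e h t = P (primitive h)"
    "AE \<omega> in N. I (\<lambda>x. e x * indicator (PiE {..<n} (\<lambda>_. {0..t})) x) \<omega> = P (\<lambda>s. W s \<omega>)"
    using add.IH(1) by blast
  obtain F' P' \<epsilon>1 where 2: "finite F'" "F' \<subseteq> {0..T}" "continuous_on UNIV P'"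
    "\<forall>p q. (\<forall>s\<in>F'. p s = q s) \<longrightarrow> P' p = P' q" "\<epsilon>1 > 0"
    "\<forall>\<epsilon> h. \<epsilon> < \<epsilon>1 \<longrightarrow> square_integrable (restrict_space lborel {0..T}) h \<longrightarrow>
       off_diagonal_integral n T \<epsilon> e' h t = P' (primitive h)"
    "AE \<omega> in N. I (\<lambda>x. e' x * indicator (PiE {..<n} (\<lambda>_. {0..t})) x) \<omega> = P' (\<lambda>s. W s \<omega>)"
    using add.IH(2) by blast
  note si = add.hyps[THEN square_integrable_step]
  have Q: "PiE {..<n} (\<lambda>_. {0..t}) \<in> sets (lborel_cube n T)" using t by (intro cube_in_sets) auto
  have "AE \<omega> in N. I (\<lambda>x. e x * indicator (PiE {..<n} (\<lambda>_. {0..t})) x + e' x * indicator (PiE {..<n} (\<lambda>_. {0..t})) x) \<omega>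
    = I (\<lambda>x. e x * indicator (PiE {..<n} (\<lambda>_. {0..t})) x) \<omega> + I (\<lambda>x. e' x * indicator (PiE {..<n} (\<lambda>_. {0..t})) x) \<omega>"
    using I square_integrable_mult_indicator[OF si(1) Q] square_integrable_mult_indicator[OF si(2) Q]
    unfolding multiple_wiener_ito_integral_def by blast
  then have "AE \<omega> in N. I (\<lambda>x. (e x + e' x) * indicator (PiE {..<n} (\<lambda>_. {0..t})) x) \<omega>
      = P (\<lambda>s. W s \<omega>) + P' (\<lambda>s. W s \<omega>)"
    using 1(7) 2(7) unfolding distrib_right by eventually_elim simp
  moreover have "off_diagonal_integral n T \<epsilon> (\<lambda>x. e x + e' x) h t = P (primitive h) + P' (primitive h)"
    if "\<epsilon> < min \<epsilon>0 \<epsilon>1" "square_integrable (restrict_space lborel {0..T}) h" for \<epsilon> h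
    using that 1(6) 2(6) t by (subst off_diagonal_integral_add[OF si that(2)]) auto
  moreover have "\<forall>p q. (\<forall>s\<in>F \<union> F'. p s = q s) \<longrightarrow> P p + P' p = P q + P' q"
    using 1(4) 2(4) by (metis UnCI)
  moreover have "continuous_on UNIV (\<lambda>p. P p + P' p)"
    by (intro continuous_on_add 1(3) 2(3))
  moreover have "min \<epsilon>0 \<epsilon>1 > 0" using 1(5) 2(5) by simp
  ultimately show ?case using 1(1,2) 2(1,2)
    by (intro exI[of _ "F \<union> F'"] exI[of _ "\<lambda>p. P p + P' p"] exI[of _ "min \<epsilon>0 \<epsilon>1"] conjI)
       (simp_all only: finite_Un Un_least simp_thms, blast)
next
  case (scale e c)
  obtain F P \<epsilon>0 where 1: "finite F" "F \<subseteq> {0..T}" "continuous_on UNIV P"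
    "\<forall>p q. (\<forall>s\<in>F. p s = q s) \<longrightarrow> P p = P q" "\<epsilon>0 > 0"
    "\<forall>\<epsilon> h. \<epsilon> < \<epsilon>0 \<longrightarrow> square_integrable (restrict_space lborel {0..T}) h \<longrightarrow>
       off_diagonal_integral n T \<epsilon> e h t = P (primitive h)"
    "AE \<omega> in N. I (\<lambda>x. e x * indicator (PiE {..<n} (\<lambda>_. {0..t})) x) \<omega> = P (\<lambda>s. W s \<omega>)"
    using scale.IH by blast
  have Q: "PiE {..<n} (\<lambda>_. {0..t}) \<in> sets (lborel_cube n T)" using t by (intro cube_in_sets) auto
  have "AE \<omega> in N. I (\<lambda>x. c * (e x * indicator (PiE {..<n} (\<lambda>_. {0..t})) x)) \<omega>
    = c * I (\<lambda>x. e x * indicator (PiE {..<n} (\<lambda>_. {0..t})) x) \<omega>"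
    using I square_integrable_mult_indicator[OF square_integrable_step[OF scale.hyps] Q]
    unfolding multiple_wiener_ito_integral_def by blast
  then have "AE \<omega> in N. I (\<lambda>x. c * e x * indicator (PiE {..<n} (\<lambda>_. {0..t})) x) \<omega> = c * P (\<lambda>s. W s \<omega>)"
    using 1(7) unfolding mult.assoc by eventually_elim simp
  moreover have "\<forall>p q. (\<forall>s\<in>F. p s = q s) \<longrightarrow> c * P p = c * P q" using 1(4) by metis
  moreover have "continuous_on UNIV (\<lambda>p. c * P p)"
    by (intro continuous_on_mult_left 1(3))
  moreover have "\<forall>\<epsilon> h. \<epsilon> < \<epsilon>0 \<longrightarrow> square_integrable (restrict_space lborel {0..T}) h \<longrightarrow>
       off_diagonal_integral n T \<epsilon> (\<lambda>x. c * e x) h t = c * P (primitive h)"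
    using 1(6) by (simp add: off_diagonal_integral_scale)
  ultimately show ?case using 1(1,2,5)
    by (intro exI[of _ F] exI[of _ "\<lambda>p. c * P p"] exI[of _ \<epsilon>0] conjI)
qed

section \<open>Weak convergence through approximation in mean\<close>

text \<open>On a product of compact intervals \<open>G\<close> is uniformly continuous. The intervals are enlarged by
  1, so that they contain \<open>y\<close> as well as \<open>x\<close>, and $\sum_i 2^{-i} = 2$ converts a bound on the
  coordinates into one on the metric of the sequence space.\<close>

lemma continuous_uniform_near_bounded:
  fixes G :: "(nat \<Rightarrow> real) \<Rightarrow> real"
  assumes cont: "continuous_on UNIV G" and \<sigma>: "\<sigma> > 0"
    and dep: "\<And>x. G (\<lambda>i. if i < k then x i else 0) = G x"
  obtains \<rho> where "\<rho> > 0"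
    "\<And>x y. \<forall>i<k. \<bar>x i\<bar> \<le> R \<Longrightarrow> \<forall>i<k. \<bar>x i - y i\<bar> \<le> \<rho> \<Longrightarrow> \<bar>G x - G y\<bar> \<le> \<sigma>"
proof -
  define S where "S i = (if i < k then {-(R+1)..R+1} else {0::real})" for i
  have "compactin (product_topology (\<lambda>_::nat. euclideanreal) UNIV) (PiE UNIV S)"
    unfolding compactin_PiE by (auto simp: S_def)
  then have comp: "compact (PiE UNIV S)"
    by (simp add: euclidean_product_topology)
  have "uniformly_continuous_on (PiE UNIV S) G"
    by (rule compact_uniformly_continuous[OF continuous_on_subset[OF cont] comp]) simp
  then obtain d where d: "d > 0"
    "\<And>x y. x \<in> PiE UNIV S \<Longrightarrow> y \<in> PiE UNIV S \<Longrightarrow> dist y x < d \<Longrightarrow> dist (G y) (G x) < \<sigma>"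
    using \<sigma> unfolding uniformly_continuous_on_def by meson
  define \<rho> where "\<rho> = min 1 (d / 4)"
  have "\<bar>G x - G y\<bar> \<le> \<sigma>" if x: "\<forall>i<k. \<bar>x i\<bar> \<le> R" and xy: "\<forall>i<k. \<bar>x i - y i\<bar> \<le> \<rho>" for x y
  proof -
    define u where "u i = (if i < k then x i else 0)" for i
    define v where "v i = (if i < k then y i else 0)" for i
    have u: "u \<in> PiE UNIV S" using x by (fastforce simp: u_def S_def)
    have v: "v \<in> PiE UNIV S"
    proof (rule PiE_I)
      fix i show "v i \<in> S i"
        using x[rule_format, of i] xy[rule_format, of i]
        by (auto simp: v_def S_def \<rho>_def split: if_splits)
    qed simp
    have le: "dist (v i) (u i) \<le> \<rho>" for i
      using xy d(1) by (auto simp: u_def v_def dist_real_def abs_minus_commute \<rho>_def)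
    have "dist v u \<le> (\<Sum>i. (1/2)^i * \<rho>)"
      unfolding dist_fun_def
    proof (rule suminf_le)
      show s: "summable (\<lambda>i. (1/2::real)^i * \<rho>)" by (intro summable_mult2 summable_geometric) simp
      show "(1/2)^i * min (dist (v (from_nat i)) (u (from_nat i))) 1 \<le> (1/2)^i * \<rho>" for i
        using le[of "from_nat i"] by (intro mult_left_mono) auto
      then show "summable (\<lambda>i. (1/2)^i * min (dist (v (from_nat i)) (u (from_nat i))) 1)"
        by (intro summable_comparison_test'[OF s]) auto
    qed
    also have "\<dots> = 2 * \<rho>"
      by (subst suminf_mult2[symmetric]) (auto simp: suminf_geometric intro: summable_geometric)
    also have "\<dots> < d" using d(1) by (simp add: \<rho>_def min_def)
    finally have "dist (G v) (G u) < \<sigma>" using d(2)[OF u v] by simp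
    moreover have "G u = G x" "G v = G y" unfolding u_def v_def by (rule dep)+
    ultimately show ?thesis by (simp add: dist_real_def abs_minus_commute)
  qed
  moreover have "\<rho> > 0" using d(1) by (simp add: \<rho>_def)
  ultimately show ?thesis using that by blast
qed

lemma borel_measurable_continuous_comp:
  fixes G :: "(nat \<Rightarrow> real) \<Rightarrow> real"
  assumes "continuous_on UNIV G" "\<And>i. U i \<in> borel_measurable M"
  shows "(\<lambda>\<omega>. G (\<lambda>i. U i \<omega>)) \<in> borel_measurable M"
  using measurable_coordinatewise_then_product[of "\<lambda>\<omega> i. U i \<omega>" M] assms
  by (intro borel_measurable_continuous_on[OF assms(1)]) auto

text \<open>Off the event that some coordinate of \<open>U\<close> exceeds \<open>R\<close> or moves by more than \<open>\<rho>\<close>, the values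
  of \<open>G\<close> at \<open>U\<close> and \<open>V\<close> differ by at most \<open>\<sigma>\<close>; on that event they differ by at most \<open>2 * B\<close>, and
  Markov's inequality bounds its probability.\<close>

lemma expectation_diff_le:
  fixes G :: "(nat \<Rightarrow> real) \<Rightarrow> real"
  assumes P: "prob_space M"
    and cont: "continuous_on UNIV G" and B: "\<And>x. \<bar>G x\<bar> \<le> B"
    and near: "\<And>x y. \<forall>i<k. \<bar>x i\<bar> \<le> R \<Longrightarrow> \<forall>i<k. \<bar>x i - y i\<bar> \<le> \<rho> \<Longrightarrow> \<bar>G x - G y\<bar> \<le> \<sigma>"
    and pos: "R > 0" "\<rho> > 0" "\<sigma> \<ge> 0"
    and meas: "\<And>i. U i \<in> borel_measurable M" "\<And>i. V i \<in> borel_measurable M"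
    and U: "\<And>i. i < k \<Longrightarrow> (\<integral>\<^sup>+\<omega>. ennreal \<bar>U i \<omega>\<bar> \<partial>M) \<le> ennreal A"
    and UV: "\<And>i. i < k \<Longrightarrow> (\<integral>\<^sup>+\<omega>. ennreal \<bar>U i \<omega> - V i \<omega>\<bar> \<partial>M) \<le> ennreal \<delta>"
    and nn: "A \<ge> 0" "\<delta> \<ge> 0"
  shows "\<bar>(LINT \<omega>|M. G (\<lambda>i. U i \<omega>)) - (LINT \<omega>|M. G (\<lambda>i. V i \<omega>))\<bar>
    \<le> \<sigma> + 2 * B * real k * (A / R + \<delta> / \<rho>)"
proof -
  interpret prob_space M by fact
  have B0: "B \<ge> 0" using B[of undefined] by linarith
  have bound: "integrable M X \<and> (LINT \<omega>|M. \<bar>X \<omega>\<bar>) \<le> c"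
    if "X \<in> borel_measurable M" "(\<integral>\<^sup>+\<omega>. ennreal \<bar>X \<omega>\<bar> \<partial>M) \<le> ennreal c" "c \<ge> 0"
    for X :: "'a \<Rightarrow> real" and c
  proof -
    have i: "integrable M X"
      using that by (auto simp: integrable_iff_bounded intro: le_less_trans)
    have "ennreal (LINT \<omega>|M. \<bar>X \<omega>\<bar>) \<le> ennreal c"
      using that(2) nn_integral_eq_integral[of M "\<lambda>\<omega>. \<bar>X \<omega>\<bar>"] i by simp
    then show ?thesis using i that(3) by simp
  qed
  have iG: "integrable M (\<lambda>\<omega>. G (\<lambda>i. X i \<omega>))" if "\<And>i. X i \<in> borel_measurable M" for X
    by (rule integrable_const_bound[of _ B]) (use B that borel_measurable_continuous_comp[OF cont] in auto)
  have bU: "integrable M (U i) \<and> (LINT \<omega>|M. \<bar>U i \<omega>\<bar>) \<le> A" if "i < k" for i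
    using bound[OF meas(1) U nn(1)] that by simp
  have bV: "integrable M (\<lambda>\<omega>. U i \<omega> - V i \<omega>) \<and> (LINT \<omega>|M. \<bar>U i \<omega> - V i \<omega>\<bar>) \<le> \<delta>" if "i < k" for i
    using bound[of "\<lambda>\<omega>. U i \<omega> - V i \<omega>", OF _ UV nn(2)] meas that by simp
  let ?h = "\<lambda>\<omega>. \<sigma> + 2 * B * (\<Sum>i<k. \<bar>U i \<omega>\<bar> / R + \<bar>U i \<omega> - V i \<omega>\<bar> / \<rho>)"
  have pw: "\<bar>G (\<lambda>i. U i \<omega>) - G (\<lambda>i. V i \<omega>)\<bar> \<le> ?h \<omega>" for \<omega>
  proof (cases "(\<forall>i<k. \<bar>U i \<omega>\<bar> \<le> R) \<and> (\<forall>i<k. \<bar>U i \<omega> - V i \<omega>\<bar> \<le> \<rho>)")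
    case True
    have "0 \<le> 2 * B * (\<Sum>i<k. \<bar>U i \<omega>\<bar> / R + \<bar>U i \<omega> - V i \<omega>\<bar> / \<rho>)"
      using B0 pos by (intro mult_nonneg_nonneg sum_nonneg add_nonneg_nonneg divide_nonneg_nonneg) auto
    moreover have "\<bar>G (\<lambda>i. U i \<omega>) - G (\<lambda>i. V i \<omega>)\<bar> \<le> \<sigma>"
      using True near[of "\<lambda>i. U i \<omega>" "\<lambda>i. V i \<omega>"] by blast
    ultimately show ?thesis by linarith
  next
    case False
    then obtain j where j: "j < k" "R < \<bar>U j \<omega>\<bar> \<or> \<rho> < \<bar>U j \<omega> - V j \<omega>\<bar>" by (auto simp: not_le)
    have nonneg: "0 \<le> \<bar>U i \<omega>\<bar> / R" "0 \<le> \<bar>U i \<omega> - V i \<omega>\<bar> / \<rho>" for i using pos by auto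
    have "1 \<le> \<bar>U j \<omega>\<bar> / R + \<bar>U j \<omega> - V j \<omega>\<bar> / \<rho>"
      using j(2)
    proof
      assume "R < \<bar>U j \<omega>\<bar>"
      then have "1 \<le> \<bar>U j \<omega>\<bar> / R" using pos by simp
      then show ?thesis using nonneg(2)[of j] by linarith
    next
      assume "\<rho> < \<bar>U j \<omega> - V j \<omega>\<bar>"
      then have "1 \<le> \<bar>U j \<omega> - V j \<omega>\<bar> / \<rho>" using pos by simp
      then show ?thesis using nonneg(1)[of j] by linarith
    qed
    also have "\<dots> \<le> (\<Sum>i<k. \<bar>U i \<omega>\<bar> / R + \<bar>U i \<omega> - V i \<omega>\<bar> / \<rho>)"
      using j(1) nonneg by (intro member_le_sum) (auto intro: add_nonneg_nonneg)
    finally have "2 * B * 1 \<le> 2 * B * (\<Sum>i<k. \<bar>U i \<omega>\<bar> / R + \<bar>U i \<omega> - V i \<omega>\<bar> / \<rho>)"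
      using B0 by (intro mult_left_mono) auto
    then show ?thesis
      using B[of "\<lambda>i. U i \<omega>"] B[of "\<lambda>i. V i \<omega>"] pos(3) by linarith
  qed
  have ih: "integrable M (\<lambda>\<omega>. \<bar>U i \<omega>\<bar> / R + \<bar>U i \<omega> - V i \<omega>\<bar> / \<rho>)" if "i < k" for i
    using bU[OF that] bV[OF that] by (intro Bochner_Integration.integrable_add integrable_divide_zero) auto
  have ih': "integrable M ?h"
    by (rule Bochner_Integration.integrable_add, simp,
        intro integrable_mult_right Bochner_Integration.integrable_sum ih, simp)
  have "\<bar>(LINT \<omega>|M. G (\<lambda>i. U i \<omega>)) - (LINT \<omega>|M. G (\<lambda>i. V i \<omega>))\<bar>
      = \<bar>LINT \<omega>|M. G (\<lambda>i. U i \<omega>) - G (\<lambda>i. V i \<omega>)\<bar>"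
    using iG meas by simp
  also have "\<dots> \<le> (LINT \<omega>|M. ?h \<omega>)"
    using pw iG meas ih'
    by (intro order_trans[OF integral_abs_bound] integral_mono) auto
  also have "\<dots> = \<sigma> + 2 * B * (\<Sum>i<k. (LINT \<omega>|M. \<bar>U i \<omega>\<bar> / R + \<bar>U i \<omega> - V i \<omega>\<bar> / \<rho>))"
  proof -
    have "integrable M (\<lambda>\<omega>. 2 * B * (\<Sum>i<k. \<bar>U i \<omega>\<bar> / R + \<bar>U i \<omega> - V i \<omega>\<bar> / \<rho>))"
      by (intro integrable_mult_right Bochner_Integration.integrable_sum ih) simp
    then have "(LINT \<omega>|M. ?h \<omega>) = \<sigma> + (LINT \<omega>|M. 2 * B * (\<Sum>i<k. \<bar>U i \<omega>\<bar> / R + \<bar>U i \<omega> - V i \<omega>\<bar> / \<rho>))"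
      by (subst Bochner_Integration.integral_add) (simp_all add: prob_space)
    also have "(LINT \<omega>|M. 2 * B * (\<Sum>i<k. \<bar>U i \<omega>\<bar> / R + \<bar>U i \<omega> - V i \<omega>\<bar> / \<rho>))
        = 2 * B * (\<Sum>i<k. (LINT \<omega>|M. \<bar>U i \<omega>\<bar> / R + \<bar>U i \<omega> - V i \<omega>\<bar> / \<rho>))"
      by (subst integral_mult_right_zero, subst Bochner_Integration.integral_sum) (simp_all add: ih)
    finally show ?thesis .
  qed
  also have "(\<Sum>i<k. (LINT \<omega>|M. \<bar>U i \<omega>\<bar> / R + \<bar>U i \<omega> - V i \<omega>\<bar> / \<rho>)) \<le> (\<Sum>i<k. A / R + \<delta> / \<rho>)"
  proof (rule sum_mono)
    fix i assume "i \<in> {..<k}"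
    then have i: "i < k" by simp
    have "(LINT \<omega>|M. \<bar>U i \<omega>\<bar> / R + \<bar>U i \<omega> - V i \<omega>\<bar> / \<rho>)
        = (LINT \<omega>|M. \<bar>U i \<omega>\<bar>) / R + (LINT \<omega>|M. \<bar>U i \<omega> - V i \<omega>\<bar>) / \<rho>"
      using bU[OF i] bV[OF i] by (subst Bochner_Integration.integral_add) auto
    also have "\<dots> \<le> A / R + \<delta> / \<rho>"
      using bU[OF i] bV[OF i] pos by (intro add_mono divide_right_mono) auto
    finally show "(LINT \<omega>|M. \<bar>U i \<omega>\<bar> / R + \<bar>U i \<omega> - V i \<omega>\<bar> / \<rho>) \<le> A / R + \<delta> / \<rho>" .
  qed
  finally show ?thesis using B0 by (simp add: mult_left_mono mult.assoc)
qed


text \<open>The usual three-term estimate. Since the mean bounds are uniform in \<open>\<epsilon>\<close>, the radius \<open>R\<close> that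
  controls the tails and the accuracy \<open>\<delta>\<close> of the approximation can be chosen before \<open>\<epsilon>\<close>.\<close>

lemma weak_limit_by_approximation_in_mean:
  fixes G :: "(nat \<Rightarrow> real) \<Rightarrow> real" and M :: "real \<Rightarrow> 'a measure" and N :: "'b measure"
  assumes M: "\<And>\<epsilon>. \<epsilon> > 0 \<Longrightarrow> prob_space (M \<epsilon>)" and N: "prob_space N"
    and cont: "continuous_on UNIV G" and B: "\<And>x. \<bar>G x\<bar> \<le> B"
    and dep: "\<And>x. G (\<lambda>i. if i < k then x i else 0) = G x"
    and X: "\<And>\<epsilon> i. \<epsilon> > 0 \<Longrightarrow> X \<epsilon> i \<in> borel_measurable (M \<epsilon>)"
    and Z: "\<And>i. Z i \<in> borel_measurable N"
    and XA: "\<And>\<epsilon> i. \<epsilon> > 0 \<Longrightarrow> i < k \<Longrightarrow> (\<integral>\<^sup>+\<omega>. ennreal \<bar>X \<epsilon> i \<omega>\<bar> \<partial>M \<epsilon>) \<le> ennreal A"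
    and ZA: "\<And>i. i < k \<Longrightarrow> (\<integral>\<^sup>+\<omega>. ennreal \<bar>Z i \<omega>\<bar> \<partial>N) \<le> ennreal A" and A: "A \<ge> 0"
    and approx: "\<And>\<delta>. \<delta> > 0 \<Longrightarrow> \<exists>X' Z'.
      (\<forall>\<epsilon>>0. \<forall>i. X' \<epsilon> i \<in> borel_measurable (M \<epsilon>)) \<and> (\<forall>i. Z' i \<in> borel_measurable N) \<and>
      (\<forall>\<epsilon>>0. \<forall>i<k. (\<integral>\<^sup>+\<omega>. ennreal \<bar>X \<epsilon> i \<omega> - X' \<epsilon> i \<omega>\<bar> \<partial>M \<epsilon>) \<le> ennreal \<delta>) \<and>
      (\<forall>i<k. (\<integral>\<^sup>+\<omega>. ennreal \<bar>Z i \<omega> - Z' i \<omega>\<bar> \<partial>N) \<le> ennreal \<delta>) \<and>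
      ((\<lambda>\<epsilon>. LINT \<omega>|M \<epsilon>. G (\<lambda>i. X' \<epsilon> i \<omega>)) \<longlongrightarrow> (LINT \<omega>|N. G (\<lambda>i. Z' i \<omega>))) (at_right 0)"
  shows "((\<lambda>\<epsilon>. LINT \<omega>|M \<epsilon>. G (\<lambda>i. X \<epsilon> i \<omega>)) \<longlongrightarrow> (LINT \<omega>|N. G (\<lambda>i. Z i \<omega>))) (at_right 0)"
proof (rule tendstoI)
  fix e :: real assume e: "e > 0"
  define \<sigma> where "\<sigma> = e / 12"
  have \<sigma>: "\<sigma> > 0" using e by (simp add: \<sigma>_def)
  have B0: "B \<ge> 0" using B[of undefined] by linarith
  \<comment> \<open>\<open>R\<close> and then \<open>\<delta>\<close> make the two error terms of the preceding lemma at most \<open>\<sigma>\<close> each;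
    \<open>\<rho>\<close> depends on \<open>R\<close>, and \<open>\<delta>\<close> on \<open>\<rho>\<close>.\<close>
  define c where "c = 2 * B * real k + 1"
  have c: "c > 0" "2 * B * real k \<le> c" using B0 by (auto simp: c_def intro: add_nonneg_pos)
  define R where "R = c * (A + 1) / \<sigma>"
  have R: "R > 0" using c A \<sigma> by (simp add: R_def)
  obtain \<rho> where \<rho>: "\<rho> > 0"
    "\<And>x y. \<forall>i<k. \<bar>x i\<bar> \<le> R \<Longrightarrow> \<forall>i<k. \<bar>x i - y i\<bar> \<le> \<rho> \<Longrightarrow> \<bar>G x - G y\<bar> \<le> \<sigma>"
    using continuous_uniform_near_bounded[OF cont \<sigma> dep, of R] by metis
  define \<delta> where "\<delta> = \<sigma> * \<rho> / c"
  have \<delta>: "\<delta> > 0" using \<sigma> \<rho> c by (simp add: \<delta>_def)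
  have err: "\<sigma> + 2 * B * real k * (A / R + \<delta> / \<rho>) \<le> 3 * \<sigma>"
  proof -
    have "A / R \<le> (A + 1) / R" using R by (simp add: divide_right_mono)
    also have "\<dots> = \<sigma> / c" using A by (simp add: R_def)
    finally have "A / R + \<delta> / \<rho> \<le> 2 * \<sigma> / c"
      using \<rho>(1) by (simp add: \<delta>_def)
    then have "2 * B * real k * (A / R + \<delta> / \<rho>) \<le> c * (2 * \<sigma> / c)"
      using c B0 A R \<delta> \<rho>(1) by (intro mult_mono) auto
    then show ?thesis using c by simp
  qed
  obtain X' Z' where X': "\<And>\<epsilon> i. \<epsilon> > 0 \<Longrightarrow> X' \<epsilon> i \<in> borel_measurable (M \<epsilon>)"
    and Z': "\<And>i. Z' i \<in> borel_measurable N"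
    and dX: "\<And>\<epsilon> i. \<epsilon> > 0 \<Longrightarrow> i < k \<Longrightarrow>
       (\<integral>\<^sup>+\<omega>. ennreal \<bar>X \<epsilon> i \<omega> - X' \<epsilon> i \<omega>\<bar> \<partial>M \<epsilon>) \<le> ennreal \<delta>"
    and dZ: "\<And>i. i < k \<Longrightarrow> (\<integral>\<^sup>+\<omega>. ennreal \<bar>Z i \<omega> - Z' i \<omega>\<bar> \<partial>N) \<le> ennreal \<delta>"
    and lim: "((\<lambda>\<epsilon>. LINT \<omega>|M \<epsilon>. G (\<lambda>i. X' \<epsilon> i \<omega>)) \<longlongrightarrow> (LINT \<omega>|N. G (\<lambda>i. Z' i \<omega>))) (at_right 0)"
    using approx[OF \<delta>] by blast
  have Zd: "\<bar>(LINT \<omega>|N. G (\<lambda>i. Z i \<omega>)) - (LINT \<omega>|N. G (\<lambda>i. Z' i \<omega>))\<bar> \<le> 3 * \<sigma>"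
    by (rule order_trans[OF expectation_diff_le[OF N cont B] err])
       (use \<rho> R \<sigma> Z Z' ZA dZ A \<delta> in auto)
  have "eventually (\<lambda>\<epsilon>. \<epsilon> > (0::real)) (at_right 0)"
    by (simp add: eventually_at_right_less)
  moreover have "eventually (\<lambda>\<epsilon>. dist (LINT \<omega>|M \<epsilon>. G (\<lambda>i. X' \<epsilon> i \<omega>)) (LINT \<omega>|N. G (\<lambda>i. Z' i \<omega>)) < \<sigma>) (at_right 0)"
    using lim \<sigma> by (rule tendstoD)
  ultimately show "eventually (\<lambda>\<epsilon>. dist (LINT \<omega>|M \<epsilon>. G (\<lambda>i. X \<epsilon> i \<omega>)) (LINT \<omega>|N. G (\<lambda>i. Z i \<omega>)) < e) (at_right 0)"
  proof eventually_elim
    fix \<epsilon> :: real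
    assume \<epsilon>: "\<epsilon> > 0" and cl: "dist (LINT \<omega>|M \<epsilon>. G (\<lambda>i. X' \<epsilon> i \<omega>)) (LINT \<omega>|N. G (\<lambda>i. Z' i \<omega>)) < \<sigma>"
    have "\<bar>(LINT \<omega>|M \<epsilon>. G (\<lambda>i. X \<epsilon> i \<omega>)) - (LINT \<omega>|M \<epsilon>. G (\<lambda>i. X' \<epsilon> i \<omega>))\<bar> \<le> 3 * \<sigma>"
      by (rule order_trans[OF expectation_diff_le[OF M[OF \<epsilon>] cont B] err])
         (use \<rho> R \<sigma> X[OF \<epsilon>] X'[OF \<epsilon>] XA[OF \<epsilon>] dX[OF \<epsilon>] A \<delta> in auto)
    then show "dist (LINT \<omega>|M \<epsilon>. G (\<lambda>i. X \<epsilon> i \<omega>)) (LINT \<omega>|N. G (\<lambda>i. Z i \<omega>)) < e"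
      using Zd cl \<sigma> unfolding dist_real_def \<sigma>_def by linarith
  qed
qed

section \<open>Continuous functions of finitely many values of a path\<close>

text \<open>Continuity for the product topology on \<open>real \<Rightarrow> real\<close> and dependence on a finite set of times
  together amount to a continuous function of finitely many real variables. This form avoids
  enumerating the times when such functions are added and composed.\<close>

lemma finitely_determined_factorization:
  fixes \<Psi> :: "(real \<Rightarrow> real) \<Rightarrow> real"
  assumes F: "finite F" and cont: "continuous_on UNIV \<Psi>"
    and dep: "\<And>p q. (\<And>s. s \<in> F \<Longrightarrow> p s = q s) \<Longrightarrow> \<Psi> p = \<Psi> q"
  obtains k :: nat and t g where "\<And>i. i < k \<Longrightarrow> t i \<in> F" "continuous_on UNIV g" "range g \<subseteq> range \<Psi>"
    "\<And>p. g (\<lambda>i. if i < k then p (t i) else 0) = \<Psi> p"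
proof -
  define k where "k = card F"
  obtain t where t: "bij_betw t {..<k} F"
    using F ex_bij_betw_nat_finite unfolding k_def lessThan_atLeast0 by blast
  define pos where "pos = inv_into {..<k} t"
  have pos: "pos s < k" "t (pos s) = s" if "s \<in> F" for s
    using that t bij_betw_inv_into_right[OF t that] bij_betwE[OF bij_betw_inv_into[OF t]]
    by (auto simp: pos_def)
  define g where "g x = \<Psi> (\<lambda>s. x (pos s))" for x :: "nat \<Rightarrow> real"
  have "continuous_on UNIV (\<lambda>x::nat \<Rightarrow> real. \<lambda>s. x (pos s))"
    by (intro continuous_on_coordinatewise_then_product continuous_on_product_coordinates)
  from continuous_on_compose2[OF cont this] have "continuous_on UNIV g"
    by (simp add: g_def[abs_def])
  moreover have "t i \<in> F" if "i < k" for i using t that by (auto dest: bij_betwE)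
  moreover have "range g \<subseteq> range \<Psi>" by (auto simp: g_def)
  moreover have "g (\<lambda>i. if i < k then p (t i) else 0) = \<Psi> p" for p
    unfolding g_def using pos by (intro dep) simp
  ultimately show ?thesis using that[of k t g] by blast
qed

lemma finitely_determined_measurable:
  fixes \<Psi> :: "(real \<Rightarrow> real) \<Rightarrow> real"
  assumes F: "finite F" and cont: "continuous_on UNIV \<Psi>"
    and dep: "\<And>p q. (\<And>s. s \<in> F \<Longrightarrow> p s = q s) \<Longrightarrow> \<Psi> p = \<Psi> q"
    and Z: "\<And>s. s \<in> F \<Longrightarrow> Z s \<in> borel_measurable N"
  shows "(\<lambda>\<omega>. \<Psi> (\<lambda>s. Z s \<omega>)) \<in> borel_measurable N"
proof -
  obtain k t g where t: "\<And>i. i < k \<Longrightarrow> t i \<in> F" and g: "continuous_on UNIV (g :: (nat \<Rightarrow> real) \<Rightarrow> real)"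
    and eq: "\<And>p. g (\<lambda>i. if i < k then p (t i) else 0) = \<Psi> p"
    by (rule finitely_determined_factorization[OF F cont dep]) auto
  have "(\<lambda>\<omega>. g (\<lambda>i. if i < k then Z (t i) \<omega> else 0)) \<in> borel_measurable N"
  proof (rule borel_measurable_continuous_comp[OF g])
    fix i show "(\<lambda>\<omega>. if i < k then Z (t i) \<omega> else 0) \<in> borel_measurable N"
      by (cases "i < k") (simp_all add: t Z)
  qed
  also have "(\<lambda>\<omega>. g (\<lambda>i. if i < k then Z (t i) \<omega> else 0)) = (\<lambda>\<omega>. \<Psi> (\<lambda>s. Z s \<omega>))"
    by (intro ext eq)
  finally show ?thesis .
qed

lemma fdd_converge_in_law_functional:
  fixes \<Psi> :: "(real \<Rightarrow> real) \<Rightarrow> real"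
  assumes fdd: "fdd_converge_in_law S M X N Z" and F: "finite F" "F \<subseteq> S"
    and cont: "continuous_on UNIV \<Psi>" and bdd: "bounded (range \<Psi>)"
    and dep: "\<And>p q. (\<And>s. s \<in> F \<Longrightarrow> p s = q s) \<Longrightarrow> \<Psi> p = \<Psi> q"
  shows "((\<lambda>\<epsilon>. LINT \<omega>|M \<epsilon>. \<Psi> (\<lambda>s. X \<epsilon> s \<omega>)) \<longlongrightarrow> (LINT \<omega>|N. \<Psi> (\<lambda>s. Z s \<omega>))) (at_right 0)"
proof -
  obtain k t g where t: "\<And>i. i < k \<Longrightarrow> t i \<in> F" and g: "continuous_on UNIV (g :: (nat \<Rightarrow> real) \<Rightarrow> real)"
    and ran: "range g \<subseteq> range \<Psi>"
    and eq: "\<And>p. g (\<lambda>i. if i < k then p (t i) else 0) = \<Psi> p"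
    by (rule finitely_determined_factorization[OF F(1) cont dep]) auto
  from g have "continuous_map (Euclidean_space k) euclideanreal g"
    unfolding Euclidean_space_def euclidean_product_topology
    by (auto intro: continuous_on_subset)
  moreover have "bounded (g ` topspace (Euclidean_space k))"
    by (rule bounded_subset[OF bdd]) (use ran in auto)
  moreover have "\<forall>i<k. t i \<in> S" using t F(2) by auto
  ultimately have "((\<lambda>\<epsilon>. LINT \<omega>|M \<epsilon>. g (\<lambda>i. if i < k then X \<epsilon> (t i) \<omega> else 0)) \<longlongrightarrow>
        (LINT \<omega>|N. g (\<lambda>i. if i < k then Z (t i) \<omega> else 0))) (at_right 0)"
    using fdd unfolding fdd_converge_in_law_def by blast
  moreover have "g (\<lambda>i. if i < k then X \<epsilon> (t i) \<omega> else 0) = \<Psi> (\<lambda>s. X \<epsilon> s \<omega>)"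
    "g (\<lambda>i. if i < k then Z (t i) \<omega>' else 0) = \<Psi> (\<lambda>s. Z s \<omega>')" for \<epsilon> \<omega> \<omega>'
    by (rule eq)+
  ultimately show ?thesis by simp
qed

text \<open>Extends a test function on \<open>Euclidean_space k\<close> continuously to all sequences, by dropping the
  coordinates from \<open>k\<close> on.\<close>

lemma continuous_truncated_Euclidean:
  assumes "continuous_map (Euclidean_space k) euclideanreal g"
  shows "continuous_on UNIV (\<lambda>x::nat \<Rightarrow> real. g (\<lambda>i. if i < k then x i else 0))"
proof -
  have g: "continuous_on {x::nat \<Rightarrow> real. \<forall>i\<ge>k. x i = 0} g"
    using assms unfolding Euclidean_space_def euclidean_product_topology by simp
  have "continuous_on UNIV (\<lambda>x::nat \<Rightarrow> real. \<lambda>i. if i < k then x i else 0)"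
  proof (rule continuous_on_coordinatewise_then_product)
    fix i show "continuous_on UNIV (\<lambda>x::nat \<Rightarrow> real. if i < k then x i else 0)"
      by (cases "i < k") auto
  qed
  then show ?thesis by (rule continuous_on_compose2[OF g]) auto
qed

section \<open>Bounds and measurability for the two processes\<close>

lemma l2norm_nonneg: "0 \<le> l2norm M f"
  by (simp add: l2norm_def)

lemma (in prob_space) nn_integral_abs_le_l2norm:
  assumes f: "square_integrable M f"
  shows "(\<integral>\<^sup>+x. ennreal \<bar>f x\<bar> \<partial>M) \<le> ennreal (l2norm M f)"
proof -
  have one: "square_integrable M (\<lambda>x. 1)" by (simp add: square_integrable_def)
  have int: "integrable M f" using square_integrable_mult_integrable[OF f one] by simp
  have "(LINT x|M. \<bar>f x * 1\<bar>)\<^sup>2 \<le> (LINT x|M. (f x)\<^sup>2) * (LINT x|M. 1\<^sup>2)"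
    by (rule cauchy_schwarz_integral[OF f one])
  then have "(LINT x|M. \<bar>f x\<bar>) \<le> l2norm M f"
    unfolding l2norm_def by (intro real_le_rsqrt) (simp add: prob_space)
  then show ?thesis
    using nn_integral_eq_integral[of M "\<lambda>x. \<bar>f x\<bar>"] int by (simp add: ennreal_leI)
qed

lemma l2norm_mult_indicator_le:
  assumes f: "square_integrable M f" and A: "A \<in> sets M"
  shows "l2norm M (\<lambda>x. f x * indicator A x) \<le> l2norm M f"
  unfolding l2norm_def
proof (intro real_sqrt_le_mono integral_mono)
  show "integrable M (\<lambda>x. (f x * indicator A x)\<^sup>2)" "integrable M (\<lambda>x. (f x)\<^sup>2)"
    using f square_integrable_mult_indicator[OF f A] by (auto simp: square_integrable_def)
qed (auto simp: indicator_def)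

lemma multiple_wiener_ito_integral_l1_bound:
  assumes N: "prob_space N" and I: "multiple_wiener_ito_integral n T N W I"
  obtains K where "K \<ge> 0"
    "\<And>f t. square_integrable (lborel_cube n T) f \<Longrightarrow> t \<in> {0..T} \<Longrightarrow>
      (\<integral>\<^sup>+\<omega>. ennreal \<bar>I (\<lambda>x. f x * indicator (PiE {..<n} (\<lambda>_. {0..t})) x) \<omega>\<bar> \<partial>N)
        \<le> ennreal (K * l2norm (lborel_cube n T) f)"
proof -
  obtain K where K: "\<And>f. square_integrable (lborel_cube n T) f \<Longrightarrow>
      l2norm N (I f) \<le> K * l2norm (lborel_cube n T) f"
    using I unfolding multiple_wiener_ito_integral_def by blast
  have "(\<integral>\<^sup>+\<omega>. ennreal \<bar>I (\<lambda>x. f x * indicator (PiE {..<n} (\<lambda>_. {0..t})) x) \<omega>\<bar> \<partial>N)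
        \<le> ennreal (\<bar>K\<bar> * l2norm (lborel_cube n T) f)"
    if f: "square_integrable (lborel_cube n T) f" and t: "t \<in> {0..T}" for f t
  proof -
    let ?Q = "PiE {..<n} (\<lambda>_. {0..t})"
    have Q: "?Q \<in> sets (lborel_cube n T)" using t by (intro cube_in_sets) auto
    note fQ = square_integrable_mult_indicator[OF f Q]
    have "square_integrable N (I (\<lambda>x. f x * indicator ?Q x))"
      using I fQ unfolding multiple_wiener_ito_integral_def by blast
    then have "(\<integral>\<^sup>+\<omega>. ennreal \<bar>I (\<lambda>x. f x * indicator ?Q x) \<omega>\<bar> \<partial>N)
        \<le> ennreal (l2norm N (I (\<lambda>x. f x * indicator ?Q x)))"
      by (rule prob_space.nn_integral_abs_le_l2norm[OF N])
    also have "l2norm N (I (\<lambda>x. f x * indicator ?Q x)) \<le> K * l2norm (lborel_cube n T) (\<lambda>x. f x * indicator ?Q x)"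
      by (rule K[OF fQ])
    also have "\<dots> \<le> \<bar>K\<bar> * l2norm (lborel_cube n T) f"
      by (intro mult_mono l2norm_mult_indicator_le f Q l2norm_nonneg) auto
    finally show ?thesis by (simp add: ennreal_leI)
  qed
  then show ?thesis by (intro that[of "\<bar>K\<bar>"]) auto
qed

lemma off_diagonal_integral_measurable:
  assumes T: "T > 0" and f: "square_integrable (lborel_cube n T) f" and t: "t \<in> {0..T}"
    and h: "\<And>\<omega>. \<omega> \<in> space M \<Longrightarrow> square_integrable (restrict_space lborel {0..T}) (h \<omega>)"
    and meas: "\<And>s. s \<in> {0..T} \<Longrightarrow> (\<lambda>\<omega>. primitive (h \<omega>) s) \<in> borel_measurable M"
  shows "(\<lambda>\<omega>. off_diagonal_integral n T \<epsilon> f (h \<omega>) t) \<in> borel_measurable M"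
  unfolding off_diagonal_integral_eq_pairing
  using t by (intro product_pairing_measurable[OF T square_integrable_truncation[OF f] h meas]) auto

section \<open>Convergence of the off-diagonal integrals\<close>

theorem theorem2p3:
  fixes T :: real and n :: nat and C :: real
    and M :: "real \<Rightarrow> 'a measure" and \<eta> \<theta> :: "real \<Rightarrow> real \<Rightarrow> 'a \<Rightarrow> real"
    and N :: "'b measure" and W :: "real \<Rightarrow> 'b \<Rightarrow> real"
    and I :: "((nat \<Rightarrow> real) \<Rightarrow> real) \<Rightarrow> 'b \<Rightarrow> real"
  assumes "T > 0" and "n \<ge> 1"
    and "\<And>\<epsilon>. \<epsilon> > 0 \<Longrightarrow> prob_space (M \<epsilon>)"
    and "\<And>\<epsilon> \<omega>. \<epsilon> > 0 \<Longrightarrow> \<omega> \<in> space (M \<epsilon>) \<Longrightarrow>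
      square_integrable (restrict_space lborel {0..T}) (\<lambda>s. \<theta> \<epsilon> s \<omega>)"
    and "\<And>\<epsilon> \<omega> t. \<epsilon> > 0 \<Longrightarrow> \<omega> \<in> space (M \<epsilon>) \<Longrightarrow> t \<in> {0..T} \<Longrightarrow>
      \<eta> \<epsilon> t \<omega> = (LINT s:{0..t}|lborel. \<theta> \<epsilon> s \<omega>)"
    and "standard_brownian_motion T N W"
    and "multiple_wiener_ito_integral n T N W I"
    and "fdd_converge_in_law {0..T} M \<eta> N W"
    and "C > 0"
    and "\<And>f \<epsilon> t. square_integrable (lborel_cube n T) f \<Longrightarrow> \<epsilon> > 0 \<Longrightarrow> t \<in> {0..T} \<Longrightarrow>
      (\<integral>\<^sup>+ \<omega>. ennreal \<bar>off_diagonal_integral n T \<epsilon> f (\<lambda>s. \<theta> \<epsilon> s \<omega>) t\<bar> \<partial>M \<epsilon>)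
        \<le> ennreal (C * l2norm (lborel_cube n T) f)"
  shows "\<forall>f. square_integrable (lborel_cube n T) f \<longrightarrow>
    fdd_converge_in_law {0..T} M
      (\<lambda>\<epsilon> t \<omega>. off_diagonal_integral n T \<epsilon> f (\<lambda>s. \<theta> \<epsilon> s \<omega>) t)
      N (\<lambda>t. I (\<lambda>x. f x * indicator (PiE {..<n} (\<lambda>_. {0..t})) x))"
proof (intro allI impI)
  fix f assume f: "square_integrable (lborel_cube n T) f"
  note T = assms(1) and M = assms(3) and \<theta> = assms(4) and \<eta> = assms(5) and I = assms(7)
    and fdd = assms(8) and C = assms(9) and bound = assms(10)
  have N: "prob_space N" using assms(6) by (rule standard_brownian_motion.axioms(1))
  obtain K where K: "K \<ge> 0" and Kbound: "\<And>f t. square_integrable (lborel_cube n T) f \<Longrightarrow> t \<in> {0..T} \<Longrightarrow>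
      (\<integral>\<^sup>+\<omega>. ennreal \<bar>I (\<lambda>x. f x * indicator (PiE {..<n} (\<lambda>_. {0..t})) x) \<omega>\<bar> \<partial>N)
        \<le> ennreal (K * l2norm (lborel_cube n T) f)"
    using multiple_wiener_ito_integral_l1_bound[OF N I] by blast
  define Y where "Y g \<epsilon> t \<omega> = off_diagonal_integral n T \<epsilon> g (\<lambda>s. \<theta> \<epsilon> s \<omega>) t" for g \<epsilon> t \<omega>
  define J where "J g t = I (\<lambda>x. g x * indicator (PiE {..<n} (\<lambda>_. {0..t})) x)" for g t
  have Q: "PiE {..<n} (\<lambda>_. {0..t}) \<in> sets (lborel_cube n T)" if "t \<in> {0..T}" for t
    using that by (intro cube_in_sets) auto
  have \<eta>_meas: "\<eta> \<epsilon> s \<in> borel_measurable (M \<epsilon>)" if "\<epsilon> > 0" "s \<in> {0..T}" for \<epsilon> s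
    using fdd that unfolding fdd_converge_in_law_def by blast
  have W_meas: "W s \<in> borel_measurable N" if "s \<in> {0..T}" for s
    using fdd that unfolding fdd_converge_in_law_def by blast
  have Y_meas: "Y g \<epsilon> t \<in> borel_measurable (M \<epsilon>)"
    if g: "square_integrable (lborel_cube n T) g" and \<epsilon>: "\<epsilon> > 0" and t: "t \<in> {0..T}" for g \<epsilon> t
    unfolding Y_def[abs_def]
  proof (rule off_diagonal_integral_measurable[OF T g t \<theta>[OF \<epsilon>]])
    fix s assume s: "s \<in> {0..T}"
    show "(\<lambda>\<omega>. primitive (\<lambda>s. \<theta> \<epsilon> s \<omega>) s) \<in> borel_measurable (M \<epsilon>)"
      using \<eta>_meas[OF \<epsilon> s] by (rule measurable_cong[THEN iffD1, rotated]) (rule \<eta>[OF \<epsilon> _ s])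
  qed
  have J_meas: "J g t \<in> borel_measurable N"
    if "square_integrable (lborel_cube n T) g" "t \<in> {0..T}" for g t
    using I square_integrable_mult_indicator[OF that(1) Q[OF that(2)]]
    unfolding J_def multiple_wiener_ito_integral_def square_integrable_def[of N] by blast
  have Y_diff: "Y (\<lambda>x. g x - e x) \<epsilon> t \<omega> = Y g \<epsilon> t \<omega> - Y e \<epsilon> t \<omega>"
    if "square_integrable (lborel_cube n T) g" "square_integrable (lborel_cube n T) e"
      "\<epsilon> > 0" "t \<in> {0..T}" "\<omega> \<in> space (M \<epsilon>)" for g e \<epsilon> t \<omega>
    unfolding Y_def using that by (intro off_diagonal_integral_diff \<theta>) auto
  have J_diff: "AE \<omega> in N. J g t \<omega> - J e t \<omega> = J (\<lambda>x. g x - e x) t \<omega>"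
    if g: "square_integrable (lborel_cube n T) g" and e: "square_integrable (lborel_cube n T) e"
      and t: "t \<in> {0..T}" for g e t
  proof -
    let ?i = "indicator (PiE {..<n} (\<lambda>_. {0..t})) :: _ \<Rightarrow> real"
    have "AE \<omega> in N. I (\<lambda>x. (g x - e x) * ?i x + e x * ?i x) \<omega>
        = I (\<lambda>x. (g x - e x) * ?i x) \<omega> + I (\<lambda>x. e x * ?i x) \<omega>"
      using I square_integrable_mult_indicator[OF square_integrable_diff[OF g e] Q[OF t]]
        square_integrable_mult_indicator[OF e Q[OF t]]
      unfolding multiple_wiener_ito_integral_def by blast
    moreover have "(\<lambda>x. (g x - e x) * ?i x + e x * ?i x) = (\<lambda>x. g x * ?i x)"
      by (rule ext) (simp add: algebra_simps)
    ultimately show ?thesis unfolding J_def by (auto elim: eventually_mono)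
  qed
  have lim: "((\<lambda>\<epsilon>. LINT \<omega>|M \<epsilon>. g (\<lambda>i. if i < k then Y f \<epsilon> (t i) \<omega> else 0)) \<longlongrightarrow>
        (LINT \<omega>|N. g (\<lambda>i. if i < k then J f (t i) \<omega> else 0))) (at_right 0)"
    if t: "\<forall>i<k. t i \<in> {0..T}" and g: "continuous_map (Euclidean_space k) euclideanreal g"
      and bdd: "bounded (g ` topspace (Euclidean_space k))" for k :: nat and t g
  proof -
    \<comment> \<open>\<open>G\<close> extends the test function to all sequences; \<open>X\<close> and \<open>Z\<close> are the random vectors at
      which it is evaluated, with the integrand as a parameter.\<close>
    define G where "G x = g (\<lambda>i. if i < k then x i else 0)" for x :: "nat \<Rightarrow> real"
    have G_cont: "continuous_on UNIV G"
      unfolding G_def[abs_def] by (rule continuous_truncated_Euclidean[OF g])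
    have G_dep: "G (\<lambda>i. if i < k then x i else 0) = G x" for x by (simp add: G_def cong: if_cong)
    have G_range: "range G \<subseteq> g ` topspace (Euclidean_space k)"
      by (auto simp: G_def topspace_Euclidean_space)
    then have G_bdd: "bounded (range G)" using bdd by (rule bounded_subset[rotated])
    then obtain B where B: "\<bar>G x\<bar> \<le> B" for x by (auto simp: bounded_iff)
    define X where "X e \<epsilon> i \<omega> = (if i < k then Y e \<epsilon> (t i) \<omega> else 0)" for e \<epsilon> i \<omega>
    define Z where "Z e i \<omega> = (if i < k then J e (t i) \<omega> else 0)" for e i \<omega>
    have X_meas: "X e \<epsilon> i \<in> borel_measurable (M \<epsilon>)"
      if "square_integrable (lborel_cube n T) e" "\<epsilon> > 0" for e \<epsilon> i
      using Y_meas[OF that, of "t i"] t by (cases "i < k") (simp_all add: X_def[abs_def])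
    have Z_meas: "Z e i \<in> borel_measurable N" if "square_integrable (lborel_cube n T) e" for e i
      using J_meas[OF that, of "t i"] t by (cases "i < k") (simp_all add: Z_def[abs_def])
    let ?c = "(C + K) * l2norm (lborel_cube n T) f"
    have "((\<lambda>\<epsilon>. LINT \<omega>|M \<epsilon>. G (\<lambda>i. X f \<epsilon> i \<omega>)) \<longlongrightarrow> (LINT \<omega>|N. G (\<lambda>i. Z f i \<omega>))) (at_right 0)"
    proof (rule weak_limit_by_approximation_in_mean[OF M N G_cont B G_dep X_meas[OF f] Z_meas[OF f], where A = ?c])
      show "(\<integral>\<^sup>+\<omega>. ennreal \<bar>X f \<epsilon> i \<omega>\<bar> \<partial>M \<epsilon>) \<le> ennreal ?c" if "\<epsilon> > 0" "i < k" for \<epsilon> i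
      proof -
        have "(\<integral>\<^sup>+\<omega>. ennreal \<bar>X f \<epsilon> i \<omega>\<bar> \<partial>M \<epsilon>) \<le> ennreal (C * l2norm (lborel_cube n T) f)"
          using bound[OF f that(1), of "t i"] t that(2) by (simp add: X_def Y_def)
        also have "\<dots> \<le> ennreal ?c" using K l2norm_nonneg by (intro ennreal_leI mult_right_mono) auto
        finally show ?thesis .
      qed
      show "(\<integral>\<^sup>+\<omega>. ennreal \<bar>Z f i \<omega>\<bar> \<partial>N) \<le> ennreal ?c" if "i < k" for i
      proof -
        have "(\<integral>\<^sup>+\<omega>. ennreal \<bar>Z f i \<omega>\<bar> \<partial>N) \<le> ennreal (K * l2norm (lborel_cube n T) f)"
          using Kbound[OF f, of "t i"] t that by (simp add: Z_def J_def)
        also have "\<dots> \<le> ennreal ?c" using C l2norm_nonneg by (intro ennreal_leI mult_right_mono) auto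
        finally show ?thesis .
      qed
      show "0 \<le> ?c" using C K l2norm_nonneg by (intro mult_nonneg_nonneg) auto
    next
      fix \<delta> :: real assume \<delta>: "\<delta> > 0"
      \<comment> \<open>One accuracy serves both sides if \<open>C + K\<close> is used in place of the two separate
        constants.\<close>
      have CK: "C + K > 0" using C K by simp
      then have "(\<delta> / (C + K))\<^sup>2 > 0" using \<delta> by simp
      then obtain e where e: "e \<in> step_functions n T"
        and close: "(LINT x|lborel_cube n T. (f x - e x)\<^sup>2) < (\<delta> / (C + K))\<^sup>2"
        using step_functions_dense[OF T f] by blast
      have esi: "square_integrable (lborel_cube n T) e" by (rule square_integrable_step[OF e])
      have fe: "square_integrable (lborel_cube n T) (\<lambda>x. f x - e x)"
        by (rule square_integrable_diff[OF f esi])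
      have "l2norm (lborel_cube n T) (\<lambda>x. f x - e x) \<le> \<delta> / (C + K)"
        unfolding l2norm_def using close \<delta> CK by (intro real_le_lsqrt) auto
      then have small: "(C + K) * l2norm (lborel_cube n T) (\<lambda>x. f x - e x) \<le> \<delta>"
        using CK by (simp add: pos_le_divide_eq mult.commute)
      have Xd: "(\<integral>\<^sup>+\<omega>. ennreal \<bar>X f \<epsilon> i \<omega> - X e \<epsilon> i \<omega>\<bar> \<partial>M \<epsilon>) \<le> ennreal \<delta>"
        if \<epsilon>: "\<epsilon> > 0" and i: "i < k" for \<epsilon> i
      proof -
        have ti: "t i \<in> {0..T}" using t i by blast
        have "(\<integral>\<^sup>+\<omega>. ennreal \<bar>X f \<epsilon> i \<omega> - X e \<epsilon> i \<omega>\<bar> \<partial>M \<epsilon>)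
            = (\<integral>\<^sup>+\<omega>. ennreal \<bar>Y (\<lambda>x. f x - e x) \<epsilon> (t i) \<omega>\<bar> \<partial>M \<epsilon>)"
          using i by (intro nn_integral_cong) (simp add: X_def Y_diff[OF f esi \<epsilon> ti])
        also have "\<dots> \<le> ennreal (C * l2norm (lborel_cube n T) (\<lambda>x. f x - e x))"
          unfolding Y_def by (rule bound[OF fe \<epsilon> ti])
        also have "\<dots> \<le> ennreal \<delta>"
          using small K l2norm_nonneg[of "lborel_cube n T" "\<lambda>x. f x - e x"]
          by (intro ennreal_leI) (simp add: distrib_right add_increasing2 order_trans[rotated])
        finally show ?thesis .
      qed
      have Zd: "(\<integral>\<^sup>+\<omega>. ennreal \<bar>Z f i \<omega> - Z e i \<omega>\<bar> \<partial>N) \<le> ennreal \<delta>" if i: "i < k" for i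
      proof -
        have ti: "t i \<in> {0..T}" using t i by blast
        have "(\<integral>\<^sup>+\<omega>. ennreal \<bar>Z f i \<omega> - Z e i \<omega>\<bar> \<partial>N)
            = (\<integral>\<^sup>+\<omega>. ennreal \<bar>J (\<lambda>x. f x - e x) (t i) \<omega>\<bar> \<partial>N)"
          using J_diff[OF f esi ti] i by (intro nn_integral_cong_AE) (auto elim: eventually_mono simp: Z_def)
        also have "\<dots> \<le> ennreal (K * l2norm (lborel_cube n T) (\<lambda>x. f x - e x))"
          unfolding J_def by (rule Kbound[OF fe ti])
        also have "\<dots> \<le> ennreal \<delta>"
          using small C l2norm_nonneg[of "lborel_cube n T" "\<lambda>x. f x - e x"]
          by (intro ennreal_leI) (simp add: distrib_right add_increasing2 order_trans[rotated])
        finally show ?thesis .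
      qed
      \<comment> \<open>One common function of the path for each of the \<open>k\<close> times; all of them together read the
        path on the union of the finite sets \<open>F i\<close>.\<close>
      define rep where "rep i F P \<epsilon>0 \<longleftrightarrow> finite F \<and> F \<subseteq> {0..T} \<and>
        continuous_on UNIV (P :: (real \<Rightarrow> real) \<Rightarrow> real) \<and>
        (\<forall>p q. (\<forall>s\<in>F. p s = q s) \<longrightarrow> P p = P q) \<and> \<epsilon>0 > 0 \<and>
        (\<forall>\<epsilon> h. \<epsilon> < \<epsilon>0 \<longrightarrow> square_integrable (restrict_space lborel {0..T}) h \<longrightarrow>
           off_diagonal_integral n T \<epsilon> e h (t i) = P (primitive h)) \<and>
        (AE \<omega> in N. J e (t i) \<omega> = P (\<lambda>s. W s \<omega>))" for i F P \<epsilon>0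
      have "\<exists>F P \<epsilon>0. rep i F P \<epsilon>0" if "i < k" for i
        unfolding rep_def J_def by (rule step_function_representation[OF I _ e]) (use t that in blast)
      then obtain F P \<epsilon>0 where rep: "\<And>i. i < k \<Longrightarrow> rep i (F i) (P i) (\<epsilon>0 i)" by metis
      have F: "finite (F i)" "F i \<subseteq> {0..T}" if "i < k" for i
        using rep[OF that] by (simp_all add: rep_def)
      have P_cont: "continuous_on UNIV (P i)" if "i < k" for i
        using rep[OF that] by (simp add: rep_def)
      have P_dep: "P i p = P i q" if "i < k" "\<forall>s\<in>F i. p s = q s" for i p q
        using rep[OF that(1)] that(2) unfolding rep_def by blast
      have \<epsilon>0: "\<epsilon>0 i > 0" if "i < k" for i
        using rep[OF that] by (simp add: rep_def)
      have P_Y: "off_diagonal_integral n T \<epsilon> e h (t i) = P i (primitive h)"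
        if "i < k" "\<epsilon> < \<epsilon>0 i" "square_integrable (restrict_space lborel {0..T}) h" for i \<epsilon> h
        using rep[OF that(1)] that(2,3) unfolding rep_def by blast
      have P_J: "AE \<omega> in N. J e (t i) \<omega> = P i (\<lambda>s. W s \<omega>)" if "i < k" for i
        using rep[OF that] by (simp add: rep_def)
      define \<Psi> where "\<Psi> p = G (\<lambda>i. if i < k then P i p else 0)" for p
      have "continuous_on UNIV (\<lambda>p i. if i < k then P i p else 0)"
      proof (rule continuous_on_coordinatewise_then_product)
        fix i show "continuous_on UNIV (\<lambda>p. if i < k then P i p else 0)"
          using P_cont by (cases "i < k") auto
      qed
      then have \<Psi>_cont: "continuous_on UNIV \<Psi>"
        unfolding \<Psi>_def[abs_def] by (rule continuous_on_compose2[OF G_cont]) simp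
      have \<Psi>_bdd: "bounded (range \<Psi>)"
        using G_bdd by (rule bounded_subset) (auto simp: \<Psi>_def)
      let ?F = "\<Union>i<k. F i"
      have FT: "finite ?F" "?F \<subseteq> {0..T}" using F by auto
      have \<Psi>_dep: "\<Psi> p = \<Psi> q" if "\<And>s. s \<in> ?F \<Longrightarrow> p s = q s" for p q
      proof -
        have "P i p = P i q" if "i < k" for i
          using that \<open>\<And>s. s \<in> ?F \<Longrightarrow> p s = q s\<close> by (intro P_dep) auto
        then show ?thesis unfolding \<Psi>_def by (intro arg_cong[where f = G] ext) simp
      qed
      have "((\<lambda>\<epsilon>. LINT \<omega>|M \<epsilon>. \<Psi> (\<lambda>s. \<eta> \<epsilon> s \<omega>)) \<longlongrightarrow> (LINT \<omega>|N. \<Psi> (\<lambda>s. W s \<omega>))) (at_right 0)"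
        by (rule fdd_converge_in_law_functional[OF fdd FT \<Psi>_cont \<Psi>_bdd \<Psi>_dep])
      moreover have "eventually (\<lambda>\<epsilon>. (LINT \<omega>|M \<epsilon>. \<Psi> (\<lambda>s. \<eta> \<epsilon> s \<omega>)) = (LINT \<omega>|M \<epsilon>. G (\<lambda>i. X e \<epsilon> i \<omega>))) (at_right 0)"
      proof -
        have "eventually (\<lambda>\<epsilon>. \<epsilon> < \<epsilon>0 i) (at_right 0)" if "i < k" for i
          using \<epsilon>0[OF that] by (rule eventually_at_right_real[THEN eventually_mono]) simp
        then have "eventually (\<lambda>\<epsilon>. \<forall>i\<in>{..<k}. \<epsilon> < \<epsilon>0 i) (at_right 0)"
          by (intro eventually_ball_finite) auto
        moreover have "eventually (\<lambda>\<epsilon>. \<epsilon> > (0::real)) (at_right 0)"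
          by (simp add: eventually_at_right_less)
        ultimately show ?thesis
        proof eventually_elim
          fix \<epsilon> :: real assume less: "\<forall>i\<in>{..<k}. \<epsilon> < \<epsilon>0 i" and \<epsilon>: "\<epsilon> > 0"
          show "(LINT \<omega>|M \<epsilon>. \<Psi> (\<lambda>s. \<eta> \<epsilon> s \<omega>)) = (LINT \<omega>|M \<epsilon>. G (\<lambda>i. X e \<epsilon> i \<omega>))"
          proof (rule Bochner_Integration.integral_cong[OF refl])
            fix \<omega> assume \<omega>: "\<omega> \<in> space (M \<epsilon>)"
            have "X e \<epsilon> i \<omega> = P i (\<lambda>s. \<eta> \<epsilon> s \<omega>)" if i: "i < k" for i
            proof -
              have "X e \<epsilon> i \<omega> = P i (primitive (\<lambda>s. \<theta> \<epsilon> s \<omega>))"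
                using P_Y[OF i _ \<theta>[OF \<epsilon> \<omega>]] less i by (simp add: X_def Y_def)
              also have "\<dots> = P i (\<lambda>s. \<eta> \<epsilon> s \<omega>)"
                using F(2)[OF i] \<eta>[OF \<epsilon> \<omega>] by (intro P_dep[OF i]) auto
              finally show ?thesis .
            qed
            then have "(\<lambda>i. if i < k then P i (\<lambda>s. \<eta> \<epsilon> s \<omega>) else 0) = (\<lambda>i. X e \<epsilon> i \<omega>)"
              by (intro ext) (simp add: X_def)
            then show "\<Psi> (\<lambda>s. \<eta> \<epsilon> s \<omega>) = G (\<lambda>i. X e \<epsilon> i \<omega>)" by (simp add: \<Psi>_def)
          qed
        qed
      qed
      ultimately have "((\<lambda>\<epsilon>. LINT \<omega>|M \<epsilon>. G (\<lambda>i. X e \<epsilon> i \<omega>)) \<longlongrightarrow> (LINT \<omega>|N. \<Psi> (\<lambda>s. W s \<omega>))) (at_right 0)"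
        by (rule Lim_transform_eventually)
      moreover have "(LINT \<omega>|N. \<Psi> (\<lambda>s. W s \<omega>)) = (LINT \<omega>|N. G (\<lambda>i. Z e i \<omega>))"
      proof (rule integral_cong_AE)
        show "(\<lambda>\<omega>. \<Psi> (\<lambda>s. W s \<omega>)) \<in> borel_measurable N"
          using FT(2) by (intro finitely_determined_measurable[OF FT(1) \<Psi>_cont \<Psi>_dep] W_meas) auto
        show "(\<lambda>\<omega>. G (\<lambda>i. Z e i \<omega>)) \<in> borel_measurable N"
          by (rule borel_measurable_continuous_comp[OF G_cont Z_meas[OF esi]])
        have "AE \<omega> in N. \<forall>i\<in>{..<k}. J e (t i) \<omega> = P i (\<lambda>s. W s \<omega>)"
          using P_J by (subst AE_finite_all) auto
        then show "AE \<omega> in N. \<Psi> (\<lambda>s. W s \<omega>) = G (\<lambda>i. Z e i \<omega>)"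
        proof eventually_elim
          fix \<omega> assume "\<forall>i\<in>{..<k}. J e (t i) \<omega> = P i (\<lambda>s. W s \<omega>)"
          then have "(\<lambda>i. if i < k then P i (\<lambda>s. W s \<omega>) else 0) = (\<lambda>i. Z e i \<omega>)"
            by (intro ext) (simp add: Z_def)
          then show "\<Psi> (\<lambda>s. W s \<omega>) = G (\<lambda>i. Z e i \<omega>)" by (simp add: \<Psi>_def)
        qed
      qed
      ultimately show "\<exists>X' Z'.
        (\<forall>\<epsilon>>0. \<forall>i. X' \<epsilon> i \<in> borel_measurable (M \<epsilon>)) \<and> (\<forall>i. Z' i \<in> borel_measurable N) \<and>
        (\<forall>\<epsilon>>0. \<forall>i<k. (\<integral>\<^sup>+\<omega>. ennreal \<bar>X f \<epsilon> i \<omega> - X' \<epsilon> i \<omega>\<bar> \<partial>M \<epsilon>) \<le> ennreal \<delta>) \<and>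
        (\<forall>i<k. (\<integral>\<^sup>+\<omega>. ennreal \<bar>Z f i \<omega> - Z' i \<omega>\<bar> \<partial>N) \<le> ennreal \<delta>) \<and>
        ((\<lambda>\<epsilon>. LINT \<omega>|M \<epsilon>. G (\<lambda>i. X' \<epsilon> i \<omega>)) \<longlongrightarrow> (LINT \<omega>|N. G (\<lambda>i. Z' i \<omega>))) (at_right 0)"
        using X_meas[OF esi] Z_meas[OF esi] Xd Zd
        by (intro exI[of _ "X e"] exI[of _ "Z e"]) simp
    qed
    then show ?thesis by (simp add: G_def X_def Z_def cong: if_cong)
  qed
  have "fdd_converge_in_law {0..T} M (Y f) N (J f)"
    unfolding fdd_converge_in_law_def using Y_meas[OF f] J_meas[OF f] lim by blast
  then show "fdd_converge_in_law {0..T} M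
      (\<lambda>\<epsilon> t \<omega>. off_diagonal_integral n T \<epsilon> f (\<lambda>s. \<theta> \<epsilon> s \<omega>) t)
      N (\<lambda>t. I (\<lambda>x. f x * indicator (PiE {..<n} (\<lambda>_. {0..t})) x))"
    by (simp only: Y_def[abs_def] J_def[abs_def])
qed

end
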